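(* Let $\gamma_0$ be the $L$-shape arc and let $\mathbf z_n^*=\{z_{n,k}^*\}_{k=0}^n\subset\gamma_0$ be the family of Fejér points on $\gamma_0$ (both defined in the context), and let $L_{\mathbf z_n^*}$ denote the Lebesgue constant of $\mathbf z_n^*$ on $\gamma_0$. Then there exists a constant $c_1>0$ such that $$c_1\log^2(n)\le L_{\mathbf z_n^*}\qquad\text{for all integers } n\ge 1.$$ On the other hand, $$\limsup_{n\to\infty}\frac{L_{\mathbf z_n^*}}{\log^2(n)}=\infty .$$
   Context: The arc: $\gamma_0=\{(-1+i)x: x\in[0,27^{1/4}/\sqrt2]\}\cup\{(-1-i)x: x\in[0,27^{1/4}/\sqrt2]\}\subset\mathbb C$. The exterior conformal map of $\{|w|>1\}$ onto $\mathbb C\setminus\gamma_0$ is $\psi_0(w)=\left(w-\frac1w\right)\left(\frac{w-1}{w+1}\right)^{1/2}$, with the branch of the square root that tends to $1$ as $w\to\infty$; it is extended continuously to $|w|=1$, and the extension maps $|w|=1$ onto $\gamma_0$. Angles: for $0\le k\le\lfloor n/2\rfloor$, $\theta_{n,k}=\frac{2k\pi}{n+1}$ if $n$ is even and $\theta_{n,k}=\frac{(2k+1)\pi}{n+1}$ if $n$ is odd; for $\lfloor n/2\rfloor<k\le n$, $\theta_{n,k}=-\theta_{n,\,2\lfloor n/2\rfloor+1-k}$. Fejér points: $z_{n,k}^*=\psi_0(e^{i\theta_{n,k}})$, $k=0,\dots,n$. Lebesgue constant: for distinct points $\mathbf z_n=\{z_{n,k}\}_{k=0}^n$ on a compact set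 $X\subset\mathbb C$, $L_{\mathbf z_n}$ is the operator norm (sup-norm on $X$) of the linear operator sending $f\in C(X)$ to the polynomial of degree $\le n$ that interpolates $f$ at $\mathbf z_n$; equivalently $L_{\mathbf z_n}=\max_{z\in X}\sum_{j=0}^n|\ell_{n,j}(z)|$ with $\ell_{n,j}(z)=\prod_{k\ne j,\,0\le k\le n}\frac{z-z_{n,k}}{z_{n,j}-z_{n,k}}$. Here $X=\gamma_0$. *)

theory Defs
  imports "HOL-Analysis.Analysis" "HOL-Computational_Algebra.Polynomial"
begin

section \<open>Lebesgue constants of polynomial interpolation\<close>

definition sup_norm_on :: "complex set \<Rightarrow> (complex \<Rightarrow> complex) \<Rightarrow> real" where
  "sup_norm_on X f = (SUP x\<in>X. cmod (f x))"

text \<open>The description is well defined only for pairwise distinct nodes \<open>z 0, \<dots>, z n\<close>;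
  see \<open>ex1_interp_poly\<close> below.\<close>

definition interp_poly :: "nat \<Rightarrow> (nat \<Rightarrow> complex) \<Rightarrow> (complex \<Rightarrow> complex) \<Rightarrow> complex poly" where
  "interp_poly n z f = (THE p. degree p \<le> n \<and> (\<forall>k\<le>n. poly p (z k) = f (z k)))"

text \<open>Operator norm of \<open>f \<mapsto> interp_poly n z f\<close> on \<open>C(X)\<close>. The supremum is a real one;
  for distinct nodes in a compact \<open>X\<close> it is over a bounded set and equals the maximum of the
  Lebesgue function, see \<open>lebesgue_constant_eq\<close> below.\<close>

definition lebesgue_constant :: "complex set \<Rightarrow> nat \<Rightarrow> (nat \<Rightarrow> complex) \<Rightarrow> real" where
  "lebesgue_constant X n z =
     (SUP f\<in>{f. continuous_on X f \<and> sup_norm_on X f \<le> 1}.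
        sup_norm_on X (poly (interp_poly n z f)))"

definition lagrange_basis :: "nat \<Rightarrow> (nat \<Rightarrow> complex) \<Rightarrow> nat \<Rightarrow> complex \<Rightarrow> complex" where
  "lagrange_basis n z j x = (\<Prod>k\<in>{..n} - {j}. (x - z k) / (z j - z k))"

definition lebesgue_function :: "nat \<Rightarrow> (nat \<Rightarrow> complex) \<Rightarrow> complex \<Rightarrow> real" where
  "lebesgue_function n z x = (\<Sum>j\<le>n. cmod (lagrange_basis n z j x))"

definition lagrange_poly :: "nat \<Rightarrow> (nat \<Rightarrow> complex) \<Rightarrow> nat \<Rightarrow> complex poly" where
  "lagrange_poly n z j =
     (\<Prod>k\<in>{..n} - {j}. smult (inverse (z j - z k)) [:- z k, 1:])"

lemma poly_lagrange_poly: "poly (lagrange_poly n z j) x = lagrange_basis n z j x"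
  unfolding lagrange_poly_def lagrange_basis_def poly_prod
  by (intro prod.cong refl) (simp add: divide_inverse algebra_simps)

lemma degree_lagrange_poly:
  assumes "j \<le> n"
  shows "degree (lagrange_poly n z j) \<le> n"
proof -
  have "degree (lagrange_poly n z j)
      \<le> (\<Sum>k\<in>{..n} - {j}. degree (smult (inverse (z j - z k)) [:- z k, 1:]))"
    unfolding lagrange_poly_def by (intro order_trans[OF degree_prod_sum_le]) (simp_all add: o_def)
  also have "\<dots> \<le> (\<Sum>k\<in>{..n} - {j}. 1)"
    by (intro sum_mono) auto
  also have "\<dots> = n"
    using assms by simp
  finally show ?thesis .
qed

lemma lagrange_basis_node:
  assumes "inj_on z {..n}" "j \<le> n" "k \<le> n"
  shows "lagrange_basis n z j (z k) = (if j = k then 1 else 0)"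
proof (cases "j = k")
  case True
  have "z j - z i \<noteq> 0" if "i \<in> {..n} - {j}" for i
    using assms that by (auto dest: inj_onD)
  then show ?thesis
    using True unfolding lagrange_basis_def by (auto intro!: prod.neutral)
next
  case False
  then show ?thesis
    using assms unfolding lagrange_basis_def by (auto intro!: prod_zero)
qed

lemma lagrange_sum_interpolates:
  fixes f :: "complex \<Rightarrow> complex"
  assumes "inj_on z {..n}"
  defines "p \<equiv> \<Sum>j\<le>n. smult (f (z j)) (lagrange_poly n z j)"
  shows "degree p \<le> n \<and> (\<forall>k\<le>n. poly p (z k) = f (z k))"
proof (intro conjI allI impI)
  show "degree p \<le> n"
    unfolding p_def
    by (intro degree_sum_le) (auto intro: order_trans[OF degree_smult_le] degree_lagrange_poly)
  fix k assume "k \<le> n"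
  have "poly p (z k) = (\<Sum>j\<le>n. if j = k then f (z k) else 0)"
    unfolding p_def poly_sum
    by (intro sum.cong refl)
      (use assms \<open>k \<le> n\<close> in \<open>simp add: poly_lagrange_poly lagrange_basis_node\<close>)
  then show "poly p (z k) = f (z k)"
    using \<open>k \<le> n\<close> by simp
qed

lemma ex1_interp_poly:
  fixes f :: "complex \<Rightarrow> complex"
  assumes "inj_on z {..n}"
  shows "\<exists>!p. degree p \<le> n \<and> (\<forall>k\<le>n. poly p (z k) = f (z k))"
proof (intro ex_ex1I exI)
  show "degree (\<Sum>j\<le>n. smult (f (z j)) (lagrange_poly n z j)) \<le> n \<and>
      (\<forall>k\<le>n. poly (\<Sum>j\<le>n. smult (f (z j)) (lagrange_poly n z j)) (z k) = f (z k))"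
    by (rule lagrange_sum_interpolates[OF assms])
  fix p q
  assume "degree p \<le> n \<and> (\<forall>k\<le>n. poly p (z k) = f (z k))"
    "degree q \<le> n \<and> (\<forall>k\<le>n. poly q (z k) = f (z k))"
  moreover have "card (z ` {..n}) = Suc n"
    using assms by (simp add: card_image)
  ultimately show "p = q"
    by (intro poly_eqI_degree[of "z ` {..n}"]) auto
qed

lemma poly_interp_poly:
  assumes "inj_on z {..n}"
  shows "poly (interp_poly n z f) x = (\<Sum>j\<le>n. f (z j) * lagrange_basis n z j x)"
proof -
  have "interp_poly n z f = (\<Sum>j\<le>n. smult (f (z j)) (lagrange_poly n z j))"
    unfolding interp_poly_def
    by (intro the1_equality ex1_interp_poly lagrange_sum_interpolates assms)
  then show ?thesis
    by (simp add: poly_sum poly_lagrange_poly)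
qed

lemma continuous_on_lebesgue_function: "continuous_on X (lebesgue_function n z)"
  unfolding lebesgue_function_def poly_lagrange_poly[symmetric]
  by (intro continuous_intros)

lemma lebesgue_constant_eq:
  assumes X: "compact X" and z: "inj_on z {..n}" "z ` {..n} \<subseteq> X"
  shows "lebesgue_constant X n z = (SUP x\<in>X. lebesgue_function n z x)"
    and "\<exists>x\<in>X. lebesgue_constant X n z = lebesgue_function n z x"
proof -
  let ?B = "{f. continuous_on X f \<and> sup_norm_on X f \<le> 1}"
  have ne: "X \<noteq> {}"
    using z(2) by auto
  obtain x0 where x0: "x0 \<in> X" "\<And>x. x \<in> X \<Longrightarrow> lebesgue_function n z x \<le> lebesgue_function n z x0"
    using continuous_attains_sup[OF X ne continuous_on_lebesgue_function] by blast
  have bdd: "bdd_above ((\<lambda>x. cmod (f x)) ` X)" if "continuous_on X f" for f :: "complex \<Rightarrow> complex"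
    by (intro bounded_imp_bdd_above compact_imp_bounded compact_continuous_image
        continuous_intros that X)
  have le: "sup_norm_on X (poly (interp_poly n z f)) \<le> lebesgue_function n z x0"
    if "f \<in> ?B" for f
    unfolding sup_norm_on_def
  proof (rule cSUP_least[OF ne])
    fix x assume x: "x \<in> X"
    have f1: "cmod (f (z j)) \<le> 1" if "j \<le> n" for j
    proof -
      have "cmod (f (z j)) \<le> sup_norm_on X f"
        unfolding sup_norm_on_def
        using that z(2) \<open>f \<in> ?B\<close> by (intro cSUP_upper bdd) auto
      also have "\<dots> \<le> 1"
        using \<open>f \<in> ?B\<close> by simp
      finally show ?thesis .
    qed
    have "cmod (poly (interp_poly n z f) x)
        \<le> (\<Sum>j\<le>n. cmod (f (z j) * lagrange_basis n z j x))"
      unfolding poly_interp_poly[OF z(1)] by (rule norm_sum)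
    also have "\<dots> \<le> lebesgue_function n z x"
      unfolding lebesgue_function_def norm_mult
      using f1 by (intro sum_mono) (simp add: mult_left_le_one_le)
    also have "\<dots> \<le> lebesgue_function n z x0"
      by (rule x0(2)[OF x])
    finally show "cmod (poly (interp_poly n z f) x) \<le> lebesgue_function n z x0" .
  qed
  define g where "g w = cnj (sgn (lagrange_basis n z (the_inv_into {..n} z w) x0))" for w
  have fin: "finite (z ` {..n})"
    by simp
  obtain f where f: "continuous_on X f" "\<And>w. w \<in> z ` {..n} \<Longrightarrow> f w = g w"
    "\<And>w. w \<in> X \<Longrightarrow> cmod (f w) \<le> 1"
  proof (rule Tietze[of "z ` {..n}" g X 1])
    show "continuous_on (z ` {..n}) g"
      using fin by (rule continuous_on_finite)
    show "closedin (top_of_set X) (z ` {..n})"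
      using fin z(2) by (intro closed_subset finite_imp_closed)
    show "cmod (g w) \<le> 1" for w
      by (simp add: g_def norm_sgn)
  qed (auto intro: that)
  have fB: "f \<in> ?B"
    unfolding sup_norm_on_def using f by (auto intro!: cSUP_least simp: ne)
  have "poly (interp_poly n z f) x0 = of_real (lebesgue_function n z x0)"
  proof -
    have "f (z j) * lagrange_basis n z j x0 = of_real (cmod (lagrange_basis n z j x0))"
      if "j \<le> n" for j
    proof -
      have "f (z j) = cnj (sgn (lagrange_basis n z j x0))"
        using that f(2)[of "z j"] by (simp add: g_def the_inv_into_f_f[OF z(1)])
      moreover have "cnj (sgn c) * c = of_real (cmod c)" for c
        using complex_norm_square[of c]
        by (cases "c = 0") (simp_all add: sgn_div_norm scaleR_conv_of_real field_simps power2_eq_square)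
      ultimately show ?thesis
        by simp
    qed
    then show ?thesis
      by (simp add: poly_interp_poly[OF z(1)] lebesgue_function_def)
  qed
  moreover have "lebesgue_function n z x0 \<ge> 0"
    by (simp add: lebesgue_function_def sum_nonneg)
  ultimately have "lebesgue_function n z x0 = cmod (poly (interp_poly n z f) x0)"
    by simp
  also have "\<dots> \<le> sup_norm_on X (poly (interp_poly n z f))"
    unfolding sup_norm_on_def by (intro cSUP_upper bdd x0(1) continuous_intros)
  also have "\<dots> \<le> lebesgue_constant X n z"
    unfolding lebesgue_constant_def
    by (intro cSUP_upper fB bdd_aboveI2[of _ _ "lebesgue_function n z x0"] le)
  finally have ge: "lebesgue_function n z x0 \<le> lebesgue_constant X n z" .
  have "lebesgue_constant X n z \<le> lebesgue_function n z x0"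
    unfolding lebesgue_constant_def using fB by (intro cSUP_least le) blast+
  with ge have eq: "lebesgue_constant X n z = lebesgue_function n z x0"
    by simp
  also have "\<dots> = (SUP x\<in>X. lebesgue_function n z x)"
    using x0 by (intro cSup_eq_maximum[symmetric]) auto
  finally show "lebesgue_constant X n z = (SUP x\<in>X. lebesgue_function n z x)" .
  show "\<exists>x\<in>X. lebesgue_constant X n z = lebesgue_function n z x"
    using eq x0(1) by blast
qed


section \<open>The L-shape arc and its Fejer points\<close>

definition gamma0 :: "complex set" where
  "gamma0 =
     {(- 1 + \<i>) * complex_of_real x | x. x \<in> {0..27 powr (1/4) / sqrt 2}} \<union>
     {(- 1 - \<i>) * complex_of_real x | x. x \<in> {0..27 powr (1/4) / sqrt 2}}"

text \<open>For \<open>cmod w > 1\<close> the quotient \<open>(w - 1) / (w + 1)\<close> lies in the open right half-plane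
  (\<open>Re_quotient_pos\<close>), so the principal root is the branch tending to \<open>1\<close> at infinity
  (\<open>psi0_branch\<close>). The formula also gives the continuous
  extension to \<open>cmod w = 1\<close> (\<open>continuous_on_psi0\<close> below); at \<open>w = - 1\<close> it takes the
  correct value \<open>0\<close>, since \<open>w - 1 / w = 0\<close> there.\<close>

definition psi0 :: "complex \<Rightarrow> complex" where
  "psi0 w = (w - 1 / w) * csqrt ((w - 1) / (w + 1))"

definition fejer_angle :: "nat \<Rightarrow> nat \<Rightarrow> real" where
  "fejer_angle n k =
     (let \<theta> = (\<lambda>j. if even n then 2 * real j * pi / (real n + 1)
                   else (2 * real j + 1) * pi / (real n + 1))
      in if k \<le> n div 2 then \<theta> k else - \<theta> (2 * (n div 2) + 1 - k))"

definition fejer_point :: "nat \<Rightarrow> nat \<Rightarrow> complex" where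
  "fejer_point n k = psi0 (exp (\<i> * complex_of_real (fejer_angle n k)))"

lemma Re_quotient_nonneg:
  assumes "1 \<le> cmod w"
  shows "0 \<le> Re ((w - 1) / (w + 1))"
proof -
  have "1 \<le> (cmod w)\<^sup>2"
    using assms by simp
  then have "0 \<le> (Re w - 1) * (Re w + 1) + Im w * Im w"
    unfolding cmod_power2 by (simp add: algebra_simps power2_eq_square)
  then show ?thesis
    by (simp add: Re_divide)
qed

lemma Re_quotient_pos:
  assumes "1 < cmod w"
  shows "0 < Re ((w - 1) / (w + 1))"
proof -
  have "1 < (cmod w)\<^sup>2"
    using assms by simp
  then have "0 < (Re w - 1) * (Re w + 1) + Im w * Im w"
    unfolding cmod_power2 by (simp add: algebra_simps power2_eq_square)
  moreover have "w + 1 \<noteq> 0"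
    using assms by (metis add_eq_0_iff2 less_irrefl norm_minus_cancel norm_one)
  then have "0 < (Re (w + 1))\<^sup>2 + (Im (w + 1))\<^sup>2"
    by (simp add: complex_neq_0)
  ultimately show ?thesis
    by (simp add: Re_divide)
qed

lemma psi0_branch: "((\<lambda>w. csqrt ((w - 1) / (w + 1))) \<longlongrightarrow> 1) at_infinity"
proof -
  have "filterlim (\<lambda>w::complex. w + 1) at_infinity at_infinity"
    by (rule tendsto_add_filterlim_at_infinity'[OF filterlim_ident tendsto_const])
  then have "((\<lambda>w::complex. 1 - 2 / (w + 1)) \<longlongrightarrow> 1 - 0) at_infinity"
    by (intro tendsto_intros tendsto_divide_0[OF tendsto_const])
  moreover have "eventually (\<lambda>w::complex. 1 - 2 / (w + 1) = (w - 1) / (w + 1)) at_infinity"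
    unfolding eventually_at_infinity
  proof (intro exI[of _ 2] allI impI)
    fix w :: complex assume "2 \<le> cmod w"
    then have "w + 1 \<noteq> 0"
      by (auto simp: add_eq_0_iff2)
    then show "1 - 2 / (w + 1) = (w - 1) / (w + 1)"
      by (simp add: field_simps)
  qed
  ultimately have "((\<lambda>w::complex. (w - 1) / (w + 1)) \<longlongrightarrow> 1) at_infinity"
    by (auto elim: Lim_transform_eventually)
  moreover have "isCont csqrt 1"
    by (intro continuous_at_csqrt) simp
  ultimately show ?thesis
    using isCont_tendsto_compose by fastforce
qed

lemma norm_psi0:
  assumes "w \<noteq> 0"
  shows "cmod (psi0 w) = sqrt (cmod ((w - 1) ^ 3 * (w + 1))) / cmod w"
proof (cases "w = - 1")
  case False
  then have "w + 1 \<noteq> 0"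
    by (simp add: add_eq_0_iff2)
  have "w - 1 / w = (w - 1) * (w + 1) / w"
    using assms by (simp add: field_simps)
  then have "cmod (psi0 w) = cmod (w - 1) * cmod (w + 1) * sqrt (cmod (w - 1) / cmod (w + 1)) / cmod w"
    by (simp add: psi0_def norm_mult norm_divide)
  also have "cmod (w - 1) * cmod (w + 1) * sqrt (cmod (w - 1) / cmod (w + 1))
      = sqrt ((cmod (w - 1))\<^sup>2 * (cmod (w + 1))\<^sup>2 * (cmod (w - 1) / cmod (w + 1)))"
    by (simp only: real_sqrt_mult real_sqrt_abs abs_norm_cancel)
  also have "(cmod (w - 1))\<^sup>2 * (cmod (w + 1))\<^sup>2 * (cmod (w - 1) / cmod (w + 1))
      = cmod ((w - 1) ^ 3 * (w + 1))"
  proof -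
    have "a\<^sup>2 * b\<^sup>2 * (a / b) = a ^ 3 * b" if "b \<noteq> 0" for a b :: real
      using that by (simp add: field_simps power2_eq_square power3_eq_cube)
    then show ?thesis
      using \<open>w + 1 \<noteq> 0\<close> by (simp only: norm_mult norm_power norm_eq_zero not_False_eq_True)
  qed
  finally show ?thesis
    .
qed (simp add: psi0_def)

lemma continuous_on_psi0: "continuous_on {w. 1 \<le> cmod w} psi0"
  unfolding continuous_on_eq_continuous_within
proof
  fix w assume "w \<in> {w. 1 \<le> cmod w}"
  then have w: "1 \<le> cmod w" "w \<noteq> 0"
    by auto
  show "continuous (at w within {w. 1 \<le> cmod w}) psi0"
  proof (cases "w = 1 \<or> w = - 1")
    case True
    have "((\<lambda>v. sqrt (cmod ((v - 1) ^ 3 * (v + 1))) / cmod v)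
        \<longlongrightarrow> sqrt (cmod ((w - 1) ^ 3 * (w + 1))) / cmod w) (at w within {w. 1 \<le> cmod w})"
      using w by (intro tendsto_intros) auto
    moreover have "sqrt (cmod ((w - 1) ^ 3 * (w + 1))) / cmod w = 0"
      using True by auto
    moreover have "eventually (\<lambda>v. sqrt (cmod ((v - 1) ^ 3 * (v + 1))) / cmod v = cmod (psi0 v))
        (at w within {w. 1 \<le> cmod w})"
      unfolding eventually_at_filter
      by (intro always_eventually) (metis mem_Collect_eq norm_psi0 norm_zero not_one_le_zero)
    ultimately have "((\<lambda>v. cmod (psi0 v)) \<longlongrightarrow> 0) (at w within {w. 1 \<le> cmod w})"
      by (auto elim: Lim_transform_eventually)
    moreover have "psi0 w = 0"
      using True by (auto simp: psi0_def)
    ultimately show ?thesis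
      by (simp add: continuous_within tendsto_norm_zero_iff)
  next
    case False
    then have "w + 1 \<noteq> 0" "(w - 1) / (w + 1) \<noteq> 0"
      by (auto simp: add_eq_0_iff2)
    moreover have "(w - 1) / (w + 1) \<notin> \<real>\<^sub>\<le>\<^sub>0"
      using Re_quotient_nonneg[OF w(1)] \<open>(w - 1) / (w + 1) \<noteq> 0\<close>
      by (auto simp: complex_nonpos_Reals_iff complex_eq_iff)
    ultimately show ?thesis
      unfolding psi0_def using w
      by (intro continuous_intros continuous_within_compose2[OF _ continuous_within_csqrt]) auto
  qed
qed

end

theory Submission
  imports Defs "HOL-Complex_Analysis.Complex_Analysis" "HOL-Real_Asymp.Real_Asymp"
begin

text \<open>Both claims follow from \<open>L\<^sub>n \<ge> c * sqrt n\<close>. The map \<open>psi0\<close> folds each half of the unit circle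
  onto a leg of the arc, with the fold at the angle \<open>2 * pi / 3\<close>, and the fold is not symmetric with
  respect to the grid of angles. Hence near the tip of a leg there are two nodes whose distance, in
  the Chebyshev angle of the leg, is only \<open>O(n powr (- 3 / 2))\<close>. A Lagrange polynomial that is 1 at one of
  them and 0 at the other has a derivative of size at least \<open>c * n powr (3 / 2)\<close> in that angle, whereas
  Bernstein's inequality bounds it by \<open>3 * n * L\<^sub>n\<close>.

  The nodes are distinct for every \<open>n\<close>: a collision means
  \<open>cos \<sigma> = cos (2 * \<sigma>) * cos \<tau>\<close> with \<open>\<sigma>\<close>, \<open>\<tau>\<close> rational multiples of \<open>pi\<close>, and comparing 2-adic
  valuations in a cyclotomic ring rules this out.\<close>

subsection \<open>A trigonometric equation at rational angles\<close>

text \<open>The ring Z[\<zeta>], given by generation so that facts about all its elements follow by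
  induction. For a root of unity it is the cyclotomic ring that carries the 2-adic argument;
  divisibility is stated through explicit cofactors.\<close>

inductive_set int_adjoin :: "complex \<Rightarrow> complex set" for \<zeta> where
  of_int: "of_int a \<in> int_adjoin \<zeta>"
| gen: "\<zeta> \<in> int_adjoin \<zeta>"
| add: "x \<in> int_adjoin \<zeta> \<Longrightarrow> y \<in> int_adjoin \<zeta> \<Longrightarrow> x + y \<in> int_adjoin \<zeta>"
| mult: "x \<in> int_adjoin \<zeta> \<Longrightarrow> y \<in> int_adjoin \<zeta> \<Longrightarrow> x * y \<in> int_adjoin \<zeta>"

lemma int_adjoin_0: "0 \<in> int_adjoin \<zeta>" and int_adjoin_1: "1 \<in> int_adjoin \<zeta>"
  using int_adjoin.of_int[of 0 \<zeta>] int_adjoin.of_int[of 1 \<zeta>] by simp_all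

lemma int_adjoin_numeral: "numeral k \<in> int_adjoin \<zeta>"
  using int_adjoin.of_int[of "numeral k" \<zeta>] by simp

lemma int_adjoin_uminus: "x \<in> int_adjoin \<zeta> \<Longrightarrow> - x \<in> int_adjoin \<zeta>"
  using int_adjoin.mult[OF int_adjoin.of_int[of "-1"], of x \<zeta>] by simp

lemma int_adjoin_power: "x \<in> int_adjoin \<zeta> \<Longrightarrow> x ^ k \<in> int_adjoin \<zeta>"
  by (induction k) (auto intro: int_adjoin_1 int_adjoin.mult)

lemma int_adjoin_sum:
  "(\<And>i. i \<in> I \<Longrightarrow> f i \<in> int_adjoin \<zeta>) \<Longrightarrow> sum f I \<in> int_adjoin \<zeta>"
  by (induction I rule: infinite_finite_induct) (auto intro: int_adjoin_0 int_adjoin.add)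

text \<open>Gaussian elimination with odd pivots: \<open>d I - 2 A\<close> is invertible for odd \<open>d\<close>.\<close>

lemma odd_minus_even_system_trivial:
  fixes v :: "'a \<Rightarrow> complex" and A :: "'a \<Rightarrow> 'a \<Rightarrow> int"
  assumes "finite I" "odd d"
    and "\<And>i. i \<in> I \<Longrightarrow> of_int d * v i = 2 * (\<Sum>j\<in>I. of_int (A i j) * v j)"
  shows "\<forall>i\<in>I. v i = 0"
  using assms
proof (induction I arbitrary: d A rule: finite_induct)
  case (insert k I)
  \<comment> \<open>The diagonal pivot, odd because \<open>d\<close> is. The other rows are
    multiplied by \<open>e\<close> before substitution, so no division occurs and
    \<open>d * e\<close> is again odd.\<close>
  define e where "e = d - 2 * A k k"
  have e: "odd e"
    using insert.prems by (simp add: e_def)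
  have k: "of_int e * v k = 2 * (\<Sum>j\<in>I. of_int (A k j) * v j)"
    using insert.prems(2)[of k] insert.hyps by (simp add: e_def algebra_simps)
  have "\<forall>i\<in>I. v i = 0"
  proof (rule insert.IH)
    show "odd (d * e)"
      using e insert.prems by simp
    fix i assume i: "i \<in> I"
    have "of_int d * v i = 2 * (of_int (A i k) * v k + (\<Sum>j\<in>I. of_int (A i j) * v j))"
      using insert.prems(2)[of i] i insert.hyps by simp
    then have "of_int e * (of_int d * v i)
        = of_int e * (2 * (of_int (A i k) * v k + (\<Sum>j\<in>I. of_int (A i j) * v j)))"
      by (rule arg_cong)
    then have "of_int (d * e) * v i
        = 2 * (of_int (A i k) * (of_int e * v k) + of_int e * (\<Sum>j\<in>I. of_int (A i j) * v j))"
      by (simp only: of_int_mult mult_ac distrib_left)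
    also have "\<dots> = 2 * (\<Sum>j\<in>I. of_int (2 * A i k * A k j + e * A i j) * v j)"
      unfolding k by (simp add: sum_distrib_left sum.distrib algebra_simps)
    finally show "of_int (d * e) * v i
        = 2 * (\<Sum>j\<in>I. of_int (2 * A i k * A k j + e * A i j) * v j)" .
  qed
  moreover have "v k = 0"
  proof -
    have "(of_int e :: complex) \<noteq> 0"
      using e by auto
    then show ?thesis
      using k calculation by simp
  qed
  ultimately show ?case
    by simp
qed auto

text \<open>Exponents reduce modulo \<open>M\<close>, so the powers below \<open>M\<close> span the
  ring over the integers. Multiplication by \<open>x\<close> thus has an integer matrix on these
  powers, even if they are linearly dependent.\<close>

lemma int_adjoin_mult_power_root_of_unity:
  assumes \<zeta>: "\<zeta> ^ M = 1" "M > 0" and x: "x \<in> int_adjoin \<zeta>"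
  shows "\<exists>a :: nat \<Rightarrow> int. x * \<zeta> ^ i = (\<Sum>j<M. of_int (a j) * \<zeta> ^ j)"
proof -
  define V where "V = range (\<lambda>a :: nat \<Rightarrow> int. \<Sum>j<M. of_int (a j) * \<zeta> ^ j)"
  have scale: "of_int c * y \<in> V" if y: "y \<in> V" for c y
  proof -
    obtain a :: "nat \<Rightarrow> int" where "y = (\<Sum>j<M. of_int (a j) * \<zeta> ^ j)"
      using y by (auto simp: V_def)
    then show ?thesis
      unfolding V_def
      by (intro range_eqI[of _ _ "\<lambda>j. c * a j"]) (simp add: sum_distrib_left mult_ac)
  qed
  have add: "y + y' \<in> V" if y: "y \<in> V" "y' \<in> V" for y y'
  proof -
    obtain a b :: "nat \<Rightarrow> int" where "y = (\<Sum>j<M. of_int (a j) * \<zeta> ^ j)"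
      "y' = (\<Sum>j<M. of_int (b j) * \<zeta> ^ j)"
      using y by (auto simp: V_def)
    then show ?thesis
      unfolding V_def
      by (intro range_eqI[of _ _ "\<lambda>j. a j + b j"]) (simp add: sum.distrib algebra_simps)
  qed
  have zero: "0 \<in> V"
    unfolding V_def by (intro range_eqI[of _ _ "\<lambda>_. 0"]) simp
  have pow: "\<zeta> ^ i \<in> V" for i
  proof -
    have "\<zeta> ^ i = \<zeta> ^ (M * (i div M) + i mod M)"
      by simp
    also have "\<dots> = \<zeta> ^ (i mod M)"
      unfolding power_add power_mult using \<zeta> by simp
    also have "\<dots> = (\<Sum>j<M. if j = i mod M then \<zeta> ^ j else 0)"
      using \<zeta> by simp
    also have "\<dots> = (\<Sum>j<M. of_int (if j = i mod M then 1 else 0) * \<zeta> ^ j)"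
      by (intro sum.cong) auto
    finally show ?thesis
      unfolding V_def by (intro range_eqI[of _ _ "\<lambda>j. if j = i mod M then 1 else 0"])
  qed
  have sum: "sum f J \<in> V" if "\<And>j. j \<in> J \<Longrightarrow> f j \<in> V" for f and J :: "nat set"
    using that by (induction J rule: infinite_finite_induct) (auto simp: zero add)
  have gen: "\<zeta> * y \<in> V" if y: "y \<in> V" for y
  proof -
    obtain a :: "nat \<Rightarrow> int" where "y = (\<Sum>j<M. of_int (a j) * \<zeta> ^ j)"
      using y by (auto simp: V_def)
    then have "\<zeta> * y = (\<Sum>j<M. of_int (a j) * \<zeta> ^ Suc j)"
      by (simp add: sum_distrib_left mult_ac)
    also have "\<dots> \<in> V"
      by (intro sum scale pow)
    finally show ?thesis .
  qed
  have "\<forall>y\<in>V. x * y \<in> V"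
    using x
    by (induction rule: int_adjoin.induct) (simp_all add: gen scale add distrib_right mult.assoc)
  then show ?thesis
    using pow unfolding V_def by blast
qed

text \<open>If \<open>d = 2 * x\<close>, then \<open>d I - 2 A\<close>, with \<open>A\<close> an
  integer matrix of multiplication by \<open>x\<close>, kills the vector of powers of \<zeta>; so
  that vector vanishes, although its first entry is 1. This takes the place of a prime ideal above
  2.\<close>

lemma odd_not_even_in_int_adjoin:
  assumes \<zeta>: "\<zeta> ^ M = 1" "M > 0" and "odd d" "x \<in> int_adjoin \<zeta>"
  shows "of_int d \<noteq> 2 * x"
proof
  assume d: "of_int d = 2 * x"
  obtain A :: "nat \<Rightarrow> nat \<Rightarrow> int" where A: "\<And>i. x * \<zeta> ^ i = (\<Sum>j<M. of_int (A i j) * \<zeta> ^ j)"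
    using int_adjoin_mult_power_root_of_unity[OF \<zeta> assms(4)] by metis
  have "\<forall>i\<in>{..<M}. \<zeta> ^ i = 0"
  proof (rule odd_minus_even_system_trivial[where d = d and A = A])
    show "of_int d * \<zeta> ^ i = 2 * (\<Sum>j<M. of_int (A i j) * \<zeta> ^ j)" for i
      unfolding d A[symmetric] by simp
  qed (use assms in auto)
  then show False
    using \<zeta> by force
qed

section \<open>Divisibility by \<open>1 - z\<close> for roots of unity \<open>z\<close>\<close>

lemma one_minus_dvd_one_minus_power:
  assumes "z \<in> int_adjoin \<zeta>"
  shows "\<exists>x\<in>int_adjoin \<zeta>. 1 - z ^ k = (1 - z) * x"
proof
  show "1 - z ^ k = (1 - z) * (\<Sum>i<k. z ^ i)"
    by (rule one_diff_power_eq)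
  show "(\<Sum>i<k. z ^ i) \<in> int_adjoin \<zeta>"
    by (intro int_adjoin_sum int_adjoin_power assms)
qed

text \<open>The powers \<open>y ^ i\<close> with \<open>i < q\<close> sum to 0, so \<open>q\<close>
  is the sum of the terms \<open>1 - y ^ i\<close>, each a multiple of \<open>1 - y\<close>.\<close>

lemma one_minus_odd_root_of_unity:
  assumes y: "y \<in> int_adjoin \<zeta>" and "y ^ q = 1" "y \<noteq> 1"
  shows "\<exists>x\<in>int_adjoin \<zeta>. (1 - y) * x = of_nat q"
proof -
  have "(1 - y) * (\<Sum>i<q. y ^ i) = 0"
    using assms by (simp flip: one_diff_power_eq)
  then have "(\<Sum>i<q. y ^ i) = 0"
    using assms by simp
  then have "of_nat q = (\<Sum>i<q. 1 - y ^ i)"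
    by (simp add: sum_subtractf)
  also have "\<dots> = (1 - y) * (\<Sum>i<q. \<Sum>l<i. y ^ l)"
    by (simp add: one_diff_power_eq sum_distrib_left)
  finally show ?thesis
    using y by (intro bexI[of _ "\<Sum>i<q. \<Sum>l<i. y ^ l"]) (auto intro!: int_adjoin_sum int_adjoin_power)
qed

text \<open>Here \<open>z\<close> has order \<open>2 ^ (b + 2)\<close>, so \<open>1 - z\<close> has
  valuation \<open>1 / 2 ^ (b + 1)\<close>. Both claims write a number as 1 minus a power:
  \<open>1 + z = 1 - z ^ (2 ^ Suc b + 1)\<close> and
  \<open>2 = 1 - (z ^ 2) ^ (2 ^ b)\<close>.\<close>

lemma one_minus_sq_dvd_2:
  assumes z: "z \<in> int_adjoin \<zeta>" and b: "z ^ (2 ^ Suc b) = - 1"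
  shows "\<exists>x\<in>int_adjoin \<zeta>. (1 - z)\<^sup>2 * x = 2"
    and "\<exists>x\<in>int_adjoin \<zeta>. 1 - z\<^sup>2 = (1 - z)\<^sup>2 * x"
proof -
  have "z ^ (2 ^ Suc b + 1) = - z"
    using b by (simp add: power_add)
  then obtain x where x: "x \<in> int_adjoin \<zeta>" "1 + z = (1 - z) * x"
    using one_minus_dvd_one_minus_power[OF z, of "2 ^ Suc b + 1"] by auto
  have *: "1 - z\<^sup>2 = (1 - z)\<^sup>2 * x"
  proof -
    have "1 - z\<^sup>2 = (1 - z) * (1 + z)"
      by (simp add: algebra_simps power2_eq_square)
    then show ?thesis
      by (simp add: x(2) power2_eq_square)
  qed
  then show "\<exists>x\<in>int_adjoin \<zeta>. 1 - z\<^sup>2 = (1 - z)\<^sup>2 * x"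
    using x by blast
  have "(z\<^sup>2) ^ (2 ^ b) = - 1"
    using b by (simp flip: power_mult)
  then obtain y where y: "y \<in> int_adjoin \<zeta>" "2 = (1 - z\<^sup>2) * y"
    using one_minus_dvd_one_minus_power[OF int_adjoin_power[OF z], of 2 "2 ^ b"] by auto
  show "\<exists>x\<in>int_adjoin \<zeta>. (1 - z)\<^sup>2 * x = 2"
    using x y * by (intro bexI[of _ "x * y"]) (auto intro: int_adjoin.mult simp: mult.assoc)
qed

text \<open>The order of \<open>z\<close> either has an odd factor greater than 1 or is a power of
  2; in the latter case repeated squaring meets -1 just before 1.\<close>

lemma root_of_unity_cases:
  fixes z :: complex
  assumes "z ^ M = 1" "M > 0" "z \<noteq> 1"
  obtains a q where "odd q" "z ^ (2 ^ a * q) = 1" "z ^ (2 ^ a) \<noteq> 1"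
  | b where "z ^ (2 ^ b) = - 1"
proof -
  obtain a q where aq: "odd q" "M = 2 ^ a * q"
    using \<open>M > 0\<close> multiplicity_decompose'[of M 2] by (metis not_gr_zero odd_one)
  show ?thesis
  proof (cases "z ^ (2 ^ a) = 1")
    case False
    then show ?thesis
      using aq assms that(1) by blast
  next
    case True
    define b where "b = (LEAST b. z ^ (2 ^ b) = 1)"
    have b: "z ^ (2 ^ b) = 1"
      unfolding b_def using True by (rule LeastI)
    then obtain c where c: "b = Suc c"
      using assms(3) by (cases b) auto
    have "z ^ (2 ^ c) \<noteq> 1"
      using not_less_Least[of c "\<lambda>b. z ^ (2 ^ b) = 1"] c by (simp add: b_def)
    moreover have "(z ^ (2 ^ c))\<^sup>2 = 1"
      using b c by (simp add: mult.commute flip: power_mult)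
    ultimately show ?thesis
      using that(2) by (auto simp: power2_eq_1_iff)
  qed
qed

text \<open>A chain: \<open>1 - z\<close> divides \<open>1 - z ^ (2 ^ a)\<close>, which divides
  \<open>q\<close>. So \<open>1 - z\<close> has valuation 0 here.\<close>

lemma one_minus_dvd_odd:
  assumes z: "z \<in> int_adjoin \<zeta>" and "odd q" "z ^ (2 ^ a * q) = 1" "z ^ (2 ^ a) \<noteq> 1"
  shows "\<exists>x\<in>int_adjoin \<zeta>. (1 - z) * x = of_nat q"
proof -
  obtain y where "y \<in> int_adjoin \<zeta>" "(1 - z ^ (2 ^ a)) * y = of_nat q"
    using one_minus_odd_root_of_unity[OF int_adjoin_power[OF z], of "2 ^ a" q] assms
    by (auto simp flip: power_mult)
  moreover obtain x where "x \<in> int_adjoin \<zeta>" "1 - z ^ (2 ^ a) = (1 - z) * x"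
    using one_minus_dvd_one_minus_power[OF z] by blast
  ultimately show ?thesis
    by (intro bexI[of _ "x * y"]) (auto intro: int_adjoin.mult simp: mult_ac)
qed

text \<open>Dividing twice an odd number encodes valuation at most 1, so \<open>1 - z\<close> has
  valuation at most 1/2. It is 0 if the order has an odd factor greater than 1; among the powers of
  2 only order 2 exceeds the bound.\<close>

lemma one_minus_root_of_unity_sq_dvd:
  assumes z: "z \<in> int_adjoin \<zeta>" "z ^ M = 1" "M > 0" "z \<noteq> 1" "z \<noteq> - 1"
  shows "\<exists>d. odd d \<and> (\<exists>x\<in>int_adjoin \<zeta>. (1 - z)\<^sup>2 * x = 2 * of_int d)"
  using z(2-4)
proof (cases rule: root_of_unity_cases)
  case (1 a q)
  then obtain x where "x \<in> int_adjoin \<zeta>" "(1 - z) * x = of_nat q"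
    using one_minus_dvd_odd[OF z(1)] by blast
  then have "(1 - z)\<^sup>2 * (2 * x\<^sup>2) = 2 * of_int (int q ^ 2)" "2 * x\<^sup>2 \<in> int_adjoin \<zeta>"
    by (auto simp flip: power_mult_distrib
      intro: int_adjoin.mult int_adjoin_power int_adjoin_numeral)
  then show ?thesis
    using 1(1) by (intro exI[of _ "int q ^ 2"] conjI bexI[of _ "2 * x\<^sup>2"]) auto
next
  case (2 b)
  then obtain c where "b = Suc c"
    using z(5) by (cases b) auto
  then show ?thesis
    using one_minus_sq_dvd_2(1)[OF z(1), of c] 2 by (intro exI[of _ 1]) auto
qed

text \<open>Excluding order 4 as well lowers the bound to 1/4: for the remaining powers of 2,
  \<open>(1 - z) ^ 4\<close> divides \<open>(1 - z ^ 2) ^ 2\<close>, which divides 2.\<close>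

lemma one_minus_root_of_unity_power4_dvd:
  assumes z: "z \<in> int_adjoin \<zeta>" "z ^ M = 1" "M > 0" "z \<noteq> 1" "z \<noteq> - 1" "z\<^sup>2 \<noteq> - 1"
  shows "\<exists>d. odd d \<and> (\<exists>x\<in>int_adjoin \<zeta>. (1 - z) ^ 4 * x = 2 * of_int d)"
  using z(2-4)
proof (cases rule: root_of_unity_cases)
  case (1 a q)
  then obtain x where "x \<in> int_adjoin \<zeta>" "(1 - z) * x = of_nat q"
    using one_minus_dvd_odd[OF z(1)] by blast
  then have "(1 - z) ^ 4 * (2 * x ^ 4) = 2 * of_int (int q ^ 4)" "2 * x ^ 4 \<in> int_adjoin \<zeta>"
    by (auto simp flip: power_mult_distrib
      intro: int_adjoin.mult int_adjoin_power int_adjoin_numeral)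
  then show ?thesis
    using 1(1) by (intro exI[of _ "int q ^ 4"] conjI bexI[of _ "2 * x ^ 4"]) auto
next
  case (2 b)
  then obtain c where c: "b = Suc (Suc c)"
    using z(5,6) by (cases b; cases "b - 1") (auto simp: power2_eq_square)
  have "(z\<^sup>2) ^ (2 ^ Suc c) = - 1"
    using 2 c by (simp flip: power_mult)
  then obtain y where y: "y \<in> int_adjoin \<zeta>" "(1 - z\<^sup>2)\<^sup>2 * y = 2"
    using one_minus_sq_dvd_2(1)[OF int_adjoin_power[OF z(1)]] by blast
  obtain x where x: "x \<in> int_adjoin \<zeta>" "1 - z\<^sup>2 = (1 - z)\<^sup>2 * x"
    using one_minus_sq_dvd_2(2)[OF z(1), of "Suc c"] 2 c by auto
  have "(1 - z) ^ 4 * (x\<^sup>2 * y) = 2 * of_int 1"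
    using y(2) unfolding x(2) by (simp add: power_mult_distrib mult_ac flip: power_mult)
  then show ?thesis
    using x y by (intro exI[of _ 1]) (auto intro!: bexI[of _ "x\<^sup>2 * y"] int_adjoin.mult int_adjoin_power)
qed

lemma cis_pi_frac_power: "N > 0 \<Longrightarrow> cis (pi / real N) ^ (2 * N) = 1"
  by (simp add: Complex.DeMoivre)

text \<open>Since \<open>2 * cos \<sigma> = \<eta> + 1 / \<eta>\<close>, this number is
  \<open>1 + \<eta> ^ 2\<close> up to the unit \<eta>; its valuation is that of 1 minus the root of
  unity \<open>- \<eta> ^ 2\<close>.\<close>

lemma two_cos_in_int_adjoin:
  fixes p N :: nat
  assumes N: "N > 0" and \<sigma>: "\<sigma> = real p * pi / real N"
  obtains \<eta> where "\<eta> \<in> int_adjoin (cis (pi / real N))" "\<eta> = cis \<sigma>" "\<eta> ^ (2 * N) = 1"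
    "of_real (2 * cos \<sigma>) \<in> int_adjoin (cis (pi / real N))"
    "\<eta> * of_real (2 * cos \<sigma>) = 1 - (- \<eta>\<^sup>2)"
proof -
  let ?\<zeta> = "cis (pi / real N)"
  let ?\<eta> = "cis \<sigma>"
  have \<eta>: "?\<eta> = ?\<zeta> ^ p"
    by (simp add: Complex.DeMoivre \<sigma>)
  have inv: "cnj ?\<eta> = ?\<eta> ^ (2 * N - 1)"
  proof -
    have "?\<eta> * ?\<eta> ^ (2 * N - 1) = ?\<eta> ^ (2 * N)"
      using N by (simp flip: power_Suc)
    also have "\<dots> = 1"
      using cis_pi_frac_power[OF N] by (metis \<eta> power_mult mult.commute power_one)
    finally have "inverse ?\<eta> = ?\<eta> ^ (2 * N - 1)"
      by (rule inverse_unique)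
    then show ?thesis
      by (simp add: cis_inverse cis_cnj)
  qed
  have R: "?\<eta> \<in> int_adjoin ?\<zeta>"
    unfolding \<eta> by (intro int_adjoin_power int_adjoin.gen)
  have sum: "of_real (2 * cos \<sigma>) = ?\<eta> + cnj ?\<eta>"
    by (simp add: complex_eq_iff)
  have root: "?\<eta> ^ (2 * N) = 1"
    using cis_pi_frac_power[OF N] by (metis \<eta> power_mult mult.commute power_one)
  have mem: "of_real (2 * cos \<sigma>) \<in> int_adjoin ?\<zeta>"
    unfolding sum inv by (rule int_adjoin.add[OF R int_adjoin_power[OF R]])
  have "?\<eta> * of_real (2 * cos \<sigma>) = 1 - (- ?\<eta>\<^sup>2)"
    unfolding sum distrib_left power2_eq_square by (simp add: cis_cnj cis_mult)
  with R root mem show ?thesis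
    by (rule that[OF _ refl])
qed

text \<open>The 2-adic obstruction: the hypotheses say that the valuations of \<open>T\<close> and \<open>S\<close> are
  at most \<open>1/2\<close> and \<open>1/4\<close>, which is incompatible with \<open>S\<^sup>2 T = 2 (S + T)\<close>.\<close>

lemma valuation_obstruction:
  assumes \<zeta>: "\<zeta> ^ M = 1" "M > 0"
    and R: "S \<in> int_adjoin \<zeta>" "T \<in> int_adjoin \<zeta>" "A \<in> int_adjoin \<zeta>" "B \<in> int_adjoin \<zeta>"
    and A: "T\<^sup>2 * A = 2 * of_int d" "odd d"
    and B: "S ^ 4 * B = 2 * of_int e" "odd e"
  shows "S\<^sup>2 * T \<noteq> 2 * (S + T)"
proof
  assume eq: "S\<^sup>2 * T = 2 * (S + T)"
  let ?D = "of_int d :: complex" and ?E = "of_int e :: complex"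
  \<comment> \<open>The equation is squared and multiplied by \<open>A * B\<close>; this turns the
    left side into 4 times an odd number, and the 4 cancels.\<close>
  have "4 * (?D * ?E) = (T\<^sup>2 * A) * (S ^ 4 * B)"
    unfolding A B by simp
  also have "\<dots> = (S\<^sup>2 * T)\<^sup>2 * (A * B)"
    by algebra
  also have "\<dots> = 4 * ((S + T)\<^sup>2 * (A * B))"
    unfolding eq by algebra
  finally have de: "?D * ?E = (S + T)\<^sup>2 * (A * B)"
    by simp
  \<comment> \<open>In \<open>(S + T) ^ 2 * (A * B)\<close> the cross term is even, and so is the
    term with \<open>T ^ 2\<close> by the choice of \<open>A\<close>; hence
    \<open>S ^ 2 * (A * B)\<close> is congruent to an odd number modulo 2.\<close>
  define X where "X = S * T * A * B + ?D * B"
  have X: "S\<^sup>2 * (A * B) = ?D * ?E - 2 * X"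
  proof -
    have "?D * ?E = S\<^sup>2 * (A * B) + 2 * (S * T * A * B) + (T\<^sup>2 * A) * B"
      unfolding de by algebra
    then show ?thesis
      unfolding A X_def by (simp add: algebra_simps)
  qed
  \<comment> \<open>Multiplying by \<open>S ^ 2\<close> once more produces \<open>S ^ 4 * B\<close>,
    which is even. So \<open>S ^ 2\<close> times an odd number is even, against the congruence just
    found.\<close>
  define Y where "Y = ?E * A + S\<^sup>2 * X"
  have Y: "S\<^sup>2 * (?D * ?E) = 2 * Y"
  proof -
    have "S\<^sup>2 * (?D * ?E) - 2 * (S\<^sup>2 * X) = S\<^sup>2 * (?D * ?E - 2 * X)"
      by algebra
    also have "\<dots> = (S ^ 4 * B) * A"
      unfolding X[symmetric] by algebra
    finally show ?thesis
      unfolding B Y_def by (simp add: algebra_simps)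
  qed
  have "of_int ((d * e)\<^sup>2) = 2 * (Y * (A * B) + ?D * ?E * X)"
  proof -
    have "of_int ((d * e)\<^sup>2) = (?D * ?E) * (?D * ?E)"
      by (simp add: power2_eq_square)
    also have "\<dots> = (?D * ?E) * (S\<^sup>2 * (A * B) + 2 * X)"
      unfolding X by simp
    also have "\<dots> = (S\<^sup>2 * (?D * ?E)) * (A * B) + 2 * (?D * ?E * X)"
      by algebra
    finally show ?thesis
      unfolding Y by (simp add: algebra_simps)
  qed
  moreover have "Y * (A * B) + ?D * ?E * X \<in> int_adjoin \<zeta>"
    unfolding Y_def X_def by (intro int_adjoin.intros(1,3,4) int_adjoin_power R)
  ultimately show False
    using odd_not_even_in_int_adjoin[OF \<zeta>, of "(d * e)\<^sup>2"] A(2) B(2) by (metis even_mult_iff even_power zero_less_numeral)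
qed

text \<open>With \<open>S = 2 * cos \<sigma>\<close> and \<open>T = 2 * cos \<tau>\<close> the
  equation becomes \<open>S ^ 2 * T = 2 * (S + T)\<close>, which the valuation bounds
  exclude.\<close>

lemma cos_ne_cos_double_mult_cos:
  fixes p q N :: nat
  assumes N: "N > 0" and \<sigma>: "\<sigma> = real p * pi / real N" "0 < \<sigma>" "\<sigma> < pi"
    and \<tau>: "\<tau> = real q * pi / real N" "0 < \<tau>" "\<tau> < pi / 2"
  shows "cos \<sigma> \<noteq> cos (2 * \<sigma>) * cos \<tau>"
proof
  assume eq: "cos \<sigma> = cos (2 * \<sigma>) * cos \<tau>"
  let ?\<zeta> = "cis (pi / real N)"
  have \<zeta>: "?\<zeta> ^ (2 * N) = 1" "2 * N > 0"
    using N cis_pi_frac_power by auto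
  obtain \<eta> where \<eta>: "\<eta> \<in> int_adjoin ?\<zeta>" "\<eta> = cis \<sigma>" "\<eta> ^ (2 * N) = 1"
    and S: "of_real (2 * cos \<sigma>) \<in> int_adjoin ?\<zeta>" "\<eta> * of_real (2 * cos \<sigma>) = 1 - (- \<eta>\<^sup>2)"
    using two_cos_in_int_adjoin[OF N \<sigma>(1)] .
  obtain \<xi> where \<xi>: "\<xi> \<in> int_adjoin ?\<zeta>" "\<xi> = cis \<tau>" "\<xi> ^ (2 * N) = 1"
    and T: "of_real (2 * cos \<tau>) \<in> int_adjoin ?\<zeta>" "\<xi> * of_real (2 * cos \<tau>) = 1 - (- \<xi>\<^sup>2)"
    using two_cos_in_int_adjoin[OF N \<tau>(1)] .
  define S T where "S = complex_of_real (2 * cos \<sigma>)" and "T = complex_of_real (2 * cos \<tau>)"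
  have cos\<tau>: "cos \<tau> > 0" and sin\<tau>: "sin \<tau> > 0"
    using \<tau>(2,3) by (intro cos_gt_zero sin_gt_zero; linarith)+
  have sin\<sigma>: "sin \<sigma> > 0"
    using \<sigma>(2,3) by (rule sin_gt_zero)
  have cos2: "cos (2 * \<sigma>) = 2 * (cos \<sigma>)\<^sup>2 - 1"
    by (rule cos_double_cos)
  \<comment> \<open>The equation itself rules out the zeros of \<open>cos \<sigma>\<close> and
    \<open>cos (2 * \<sigma>)\<close>, where \<open>- \<eta> ^ 2\<close> would be 1 or have order
    4.\<close>
  have cos\<sigma>: "cos \<sigma> \<noteq> 0"
    using eq cos\<tau> cos2 by auto
  have cos2\<sigma>: "cos (2 * \<sigma>) \<noteq> 0"
    using eq cos\<sigma> by auto
  have root: "(- z\<^sup>2) ^ (2 * N) = 1" if "z ^ (2 * N) = 1" for z :: complex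
  proof -
    have "(- z\<^sup>2) ^ (2 * N) = (z\<^sup>2) ^ (2 * N)"
      by (simp add: power_mult)
    also have "\<dots> = (z ^ (2 * N))\<^sup>2"
      by (metis power_mult mult.commute)
    finally have "(- z\<^sup>2) ^ (2 * N) = (z ^ (2 * N))\<^sup>2" .
    then show ?thesis
      using that by simp
  qed
  have "\<exists>d. odd d \<and> (\<exists>x\<in>int_adjoin ?\<zeta>. (1 - (- \<xi>\<^sup>2))\<^sup>2 * x = 2 * of_int d)"
  proof (rule one_minus_root_of_unity_sq_dvd[of _ _ "2 * N"])
    show "- \<xi>\<^sup>2 \<noteq> 1"
      using cos\<tau> sin\<tau> unfolding \<xi>(2) Complex.DeMoivre by (auto simp: complex_eq_iff sin_double)
    show "- \<xi>\<^sup>2 \<noteq> - 1"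
      using cos\<tau> sin\<tau> unfolding \<xi>(2) Complex.DeMoivre by (auto simp: complex_eq_iff sin_double)
  qed (fact \<zeta>(2) root[OF \<xi>(3)] int_adjoin_uminus[OF int_adjoin_power[OF \<xi>(1)]])+
  then obtain d x where d: "odd d" "x \<in> int_adjoin ?\<zeta>" "(\<xi> * T)\<^sup>2 * x = 2 * of_int d"
    unfolding T(2)[symmetric] T_def[symmetric] by blast
  have d': "T\<^sup>2 * (\<xi>\<^sup>2 * x) = 2 * of_int d"
    unfolding d(3)[symmetric] by algebra
  have "\<exists>e. odd e \<and> (\<exists>x\<in>int_adjoin ?\<zeta>. (1 - (- \<eta>\<^sup>2)) ^ 4 * x = 2 * of_int e)"
  proof (rule one_minus_root_of_unity_power4_dvd[of _ _ "2 * N"])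
    have c: "\<eta>\<^sup>2 = cis (2 * \<sigma>)"
      by (simp add: \<eta>(2) Complex.DeMoivre)
    have c2: "(- \<eta>\<^sup>2)\<^sup>2 = cis (2 * (2 * \<sigma>))"
      unfolding c by (simp add: Complex.DeMoivre)
    show "- \<eta>\<^sup>2 \<noteq> 1"
      using cos\<sigma> sin\<sigma> unfolding c by (auto simp: complex_eq_iff cos2 sin_double)
    show "- \<eta>\<^sup>2 \<noteq> - 1"
      using cos\<sigma> sin\<sigma> unfolding c by (auto simp: complex_eq_iff sin_double)
    show "(- \<eta>\<^sup>2)\<^sup>2 \<noteq> - 1"
      using cos2\<sigma> unfolding c2 using cos_double_cos[of "2 * \<sigma>"] by (auto simp: complex_eq_iff)
  qed (fact \<zeta>(2) root[OF \<eta>(3)] int_adjoin_uminus[OF int_adjoin_power[OF \<eta>(1)]])+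
  then obtain e y where e: "odd e" "y \<in> int_adjoin ?\<zeta>" "(\<eta> * S) ^ 4 * y = 2 * of_int e"
    unfolding S(2)[symmetric] S_def[symmetric] by blast
  have e': "S ^ 4 * (\<eta> ^ 4 * y) = 2 * of_int e"
    unfolding e(3)[symmetric] by algebra
  have "S\<^sup>2 * T = 2 * (S + T)"
  proof -
    have "(2 * cos \<sigma>)\<^sup>2 * (2 * cos \<tau>) = 2 * (2 * cos \<sigma> + 2 * cos \<tau>)"
      using eq[unfolded cos2] by algebra
    then show ?thesis
      unfolding S_def T_def by (metis of_real_add of_real_mult of_real_numeral of_real_power)
  qed
  moreover have "S\<^sup>2 * T \<noteq> 2 * (S + T)"
  proof (rule valuation_obstruction[OF \<zeta> _ _ _ _ d' d(1) e' e(1)])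
    show "\<xi>\<^sup>2 * x \<in> int_adjoin ?\<zeta>" "\<eta> ^ 4 * y \<in> int_adjoin ?\<zeta>"
      using d(2) e(2) \<xi>(1) \<eta>(1) by (auto intro: int_adjoin.mult int_adjoin_power)
  qed (use S(1) T(1) in \<open>unfold S_def T_def\<close>)
  ultimately show False
    by contradiction
qed

subsection \<open>A Bernstein inequality\<close>

text \<open>Maximum principle for \<open>w ^ n * P ((w + 1 / w) / 2)\<close> on the unit disc: on
  the circle the argument of \<open>P\<close> is real and in \<open>[-1, 1]\<close>. With
  \<open>w = exp (\<i> * z)\<close> the factor \<open>w ^ n\<close> becomes the exponential
  growth.\<close>

lemma cmod_poly_cos_le:
  fixes P :: "complex poly"
  assumes deg: "degree P \<le> n"
    and M: "\<And>u::real. \<bar>u\<bar> \<le> 1 \<Longrightarrow> cmod (poly P (of_real u)) \<le> M"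
  shows "cmod (poly P (cos z)) \<le> M * exp (real n * \<bar>Im z\<bar>)"
proof -
  \<comment> \<open>Denominators are cleared so that \<open>q\<close> is holomorphic at 0
    too.\<close>
  define q where "q w = (\<Sum>i\<le>n. coeff P i * ((w\<^sup>2 + 1) / 2) ^ i * w ^ (n - i))" for w
  have q: "q w = w ^ n * poly P ((w + inverse w) / 2)" if "w \<noteq> 0" for w
  proof -
    have "poly P ((w + inverse w) / 2) = (\<Sum>i\<le>n. coeff P i * ((w + inverse w) / 2) ^ i)"
      unfolding poly_altdef by (intro sum.mono_neutral_left) (use deg in \<open>auto simp: coeff_eq_0\<close>)
    moreover have *: "w ^ n * (coeff P i * ((w + inverse w) / 2) ^ i)
        = coeff P i * ((w\<^sup>2 + 1) / 2) ^ i * w ^ (n - i)" if "i \<le> n" for i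
    proof -
      have "w ^ n = w ^ i * w ^ (n - i)"
        using that by (simp flip: power_add)
      moreover have "w * ((w + inverse w) / 2) = (w\<^sup>2 + 1) / 2"
        using \<open>w \<noteq> 0\<close> by (simp add: field_simps power2_eq_square)
      ultimately show ?thesis
        by (metis (no_types, lifting) mult.assoc mult.commute power_mult_distrib)
    qed
    ultimately show ?thesis
      unfolding q_def by (auto simp only: sum_distrib_left * atMost_iff intro!: sum.cong)
  qed
  have circle: "cmod (q w) \<le> M" if "cmod w = 1" for w
  proof -
    have "inverse w = cnj w"
      using that complex_norm_square[of w] by (intro inverse_unique) simp
    then have "(w + inverse w) / 2 = of_real (Re w)"
      by (simp add: complex_add_cnj)
    moreover have "\<bar>Re w\<bar> \<le> 1"
      using abs_Re_le_cmod[of w] that by simp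
    moreover have "w \<noteq> 0"
      using that by auto
    ultimately show ?thesis
      using M that by (simp add: q norm_mult norm_power)
  qed
  have disc: "cmod (q w) \<le> M" if "cmod w \<le> 1" for w
  proof (rule maximum_modulus_frontier[where f = q and \<xi> = w and S = "cball 0 1"])
    show "q holomorphic_on interior (cball 0 1)" "continuous_on (closure (cball 0 1)) q"
      unfolding q_def by (auto intro!: holomorphic_intros continuous_intros)
    show "w \<in> cball 0 1"
      using that by simp
  qed (auto intro: circle)
  have upper: "cmod (poly P (cos z)) \<le> M * exp (real n * Im z)" if "Im z \<ge> 0" for z
  proof -
    define w where "w = exp (\<i> * z)"
    have w: "w \<noteq> 0" "cmod w = exp (- Im z)" "cos z = (w + inverse w) / 2"
      by (auto simp: w_def cos_exp_eq exp_minus)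
    have "cmod w ^ n * cmod (poly P (cos z)) \<le> M"
      using disc[of w] that unfolding q[OF w(1)] w(3) by (simp add: norm_mult norm_power w(2))
    moreover have "cmod w ^ n * exp (real n * Im z) = 1"
      by (simp add: w(2) flip: exp_of_nat_mult exp_add)
    moreover have "cmod (poly P (cos z))
        = (cmod w ^ n * cmod (poly P (cos z))) * exp (real n * Im z)"
      using calculation(2) by (metis mult.assoc mult.commute mult_1)
    ultimately show ?thesis
      by (metis exp_ge_zero mult_right_mono)
  qed
  show ?thesis
    using upper[of z] upper[of "- z"] by (cases "Im z \<ge> 0") auto
qed

text \<open>Cauchy's estimate on circles of radius \<open>1 / n\<close>, where the function is at
  most \<open>exp 1 * M\<close>, bounds the derivative by \<open>exp 1 * n * M\<close>; 3 replaces
  \<open>exp 1\<close>.\<close>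

lemma Bernstein_cos_lipschitz:
  fixes P :: "complex poly"
  assumes deg: "degree P \<le> n" and n: "n > 0"
    and M: "\<And>u::real. \<bar>u\<bar> \<le> 1 \<Longrightarrow> cmod (poly P (of_real u)) \<le> M"
  shows "cmod (poly P (of_real (cos s)) - poly P (of_real (cos t))) \<le> 3 * real n * M * \<bar>s - t\<bar>"
proof -
  define T where "T z = poly P (cos z)" for z :: complex
  have hol: "T holomorphic_on A" for A
    unfolding T_def by (intro holomorphic_intros)
  have "M \<ge> 0"
    using M[of 0] norm_ge_zero[of "poly P 0"] by (simp del: norm_ge_zero)
  have deriv: "cmod (deriv T (of_real x)) \<le> 3 * real n * M" for x
  proof -
    have "cmod ((deriv ^^ 1) T (of_real x)) \<le> fact 1 * (M * exp 1) / (1 / real n) ^ 1"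
    proof (rule Cauchy_inequality)
      show "continuous_on (cball (of_real x) (1 / real n)) T"
        using hol by (rule holomorphic_on_imp_continuous_on)
      fix z :: complex assume z: "cmod (of_real x - z) = 1 / real n"
      have "\<bar>Im z\<bar> \<le> 1 / real n"
        using abs_Im_le_cmod[of "of_real x - z"] z by simp
      then have "real n * \<bar>Im z\<bar> \<le> 1"
        using n by (simp add: field_simps)
      have "cmod (T z) \<le> M * exp (real n * \<bar>Im z\<bar>)"
        unfolding T_def by (intro cmod_poly_cos_le deg M)
      also have "\<dots> \<le> M * exp 1"
        using \<open>M \<ge> 0\<close> \<open>real n * \<bar>Im z\<bar> \<le> 1\<close> by (intro mult_left_mono) auto
      finally show "cmod (T z) \<le> M * exp 1" .
    qed (use n hol in auto)
    also have "\<dots> = exp 1 * (real n * M)"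
      by simp
    also have "\<dots> \<le> 3 * (real n * M)"
      using exp_le \<open>M \<ge> 0\<close> by (intro mult_right_mono) auto
    finally show ?thesis
      by simp
  qed
  have "cmod (T (of_real s) - T (of_real t)) \<le> 3 * real n * M * cmod (of_real s - of_real t)"
  proof (rule field_differentiable_bound[where S = "\<real>"])
    show "convex (\<real> :: complex set)"
      by (metis convex_Reals)
    fix z :: complex assume "z \<in> \<real>"
    then show "cmod (deriv T z) \<le> 3 * real n * M"
      using deriv by (auto elim: Reals_cases)
    show "(T has_field_derivative deriv T z) (at z within \<real>)"
      using hol[of UNIV] by (metis DERIV_subset holomorphic_derivI open_UNIV UNIV_I subset_UNIV)
  qed auto
  also have "cmod (of_real s - of_real t) = \<bar>s - t\<bar>"
    by (metis norm_of_real of_real_diff)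
  finally show ?thesis
    by (simp add: T_def cos_of_real)
qed

subsection \<open>The nodes on the legs\<close>

text \<open>The squared coordinate along a leg of the image of the circle angle \<open>t\<close> or
  \<open>- t\<close>, see \<open>psi0_cis\<close>. Squaring leaves a trigonometric
  polynomial.\<close>

definition leg_sq :: "real \<Rightarrow> real" where
  "leg_sq t = 2 * sin t - sin (2 * t)"

lemma leg_sq_eq: "leg_sq t = 2 * sin t * (1 - cos t)"
  unfolding leg_sq_def sin_double by (simp add: algebra_simps)

text \<open>With mean \<sigma> and half-difference \<tau> of the two angles, the last factor is
  \<open>cos \<sigma> - cos (2 * \<sigma>) * cos \<tau>\<close>. Its zeros are the pairs folded
  together, its small values give close pairs.\<close>

lemma leg_sq_diff:
  "leg_sq a - leg_sq b = 4 * sin ((a - b) / 2) * (cos ((a + b) / 2) - cos (a + b) * cos ((a - b) / 2))"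
proof -
  have "(2 * a - 2 * b) / 2 = a - b" "(2 * a + 2 * b) / 2 = a + b"
    by simp_all
  with sin_diff_sin[of "2 * a" "2 * b"]
  have double: "sin (2 * a) - sin (2 * b) = 2 * sin (a - b) * cos (a + b)"
    by (simp only:)
  have half: "sin (a - b) = 2 * sin ((a - b) / 2) * cos ((a - b) / 2)"
    using sin_double[of "(a - b) / 2"] by (simp only: mult_2 field_sum_of_halves)
  have "leg_sq a - leg_sq b = 2 * (sin a - sin b) - (sin (2 * a) - sin (2 * b))"
    by (simp add: leg_sq_def)
  also have "\<dots> = 4 * sin ((a - b) / 2) * (cos ((a + b) / 2) - cos (a + b) * cos ((a - b) / 2))"
    unfolding double half sin_diff_sin[of a b] by algebra
  finally show ?thesis .
qed

lemma leg_sq_nonneg: "0 \<le> t \<Longrightarrow> t \<le> pi \<Longrightarrow> 0 \<le> leg_sq t"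
  by (simp add: leg_sq_eq sin_ge_zero)

lemma leg_sq_pos:
  assumes "0 < t" "t < pi"
  shows "0 < leg_sq t"
proof -
  have "cos t < cos 0"
    using assms by (intro cos_monotone_0_pi) auto
  then show ?thesis
    using assms by (simp add: leg_sq_eq sin_gt_zero)
qed

definition leg_length :: real where
  "leg_length = 27 powr (1/4) / sqrt 2"

lemma leg_length_sq: "leg_length\<^sup>2 = 3 * sqrt 3 / 2"
proof -
  have "(27 powr (1/4))\<^sup>2 = (27::real) powr (1/2)"
    by (simp add: powr_powr flip: powr_numeral)
  also have "\<dots> = 3 * sqrt 3"
    using real_sqrt_mult[of 9 3] by (simp add: powr_half_sqrt)
  finally show ?thesis
    by (simp add: leg_length_def power_divide)
qed

lemma leg_length_bounds: "1 \<le> leg_length" "leg_length \<le> 2" "leg_length\<^sup>2 \<le> 3"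
proof -
  have s: "1 \<le> sqrt 3" "sqrt 3 \<le> 2"
    by (auto intro: real_le_lsqrt)
  have "2 \<le> 3 * sqrt 3"
    using s(1) by linarith
  have "leg_length > 0"
    by (simp add: leg_length_def)
  moreover have ge: "1\<^sup>2 \<le> leg_length\<^sup>2" and le: "leg_length\<^sup>2 \<le> 3"
    unfolding leg_length_sq using s \<open>2 \<le> 3 * sqrt 3\<close> by auto
  then have "leg_length\<^sup>2 \<le> 2\<^sup>2"
    by simp
  ultimately show "1 \<le> leg_length" "leg_length \<le> 2" "leg_length\<^sup>2 \<le> 3"
    using power2_le_imp_le[OF ge] power2_le_imp_le[of leg_length 2] le by simp_all
qed

text \<open>\<open>leg_sq\<close> has its maximum at \<open>cos t = - 1 / 2\<close>. After squaring,
  the gap is a polynomial in \<open>cos t\<close> with the double factor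
  \<open>(2 * cos t + 1) ^ 2\<close> and a cofactor of at least 1/2.\<close>

lemma leg_sq_gap:
  "(leg_length\<^sup>2)\<^sup>2 - (leg_sq t)\<^sup>2 \<ge> (2 * cos t + 1)\<^sup>2 / 2"
proof -
  have "(leg_length\<^sup>2)\<^sup>2 = 27 / 4"
    unfolding leg_length_sq by (simp add: power_divide power_mult_distrib)
  moreover have "(leg_sq t)\<^sup>2 = 4 * (1 - (cos t)\<^sup>2) * (1 - cos t)\<^sup>2"
    by (simp add: leg_sq_eq power_mult_distrib sin_squared_eq)
  moreover have "27 / 4 - 4 * (1 - c\<^sup>2) * (1 - c)\<^sup>2
      = (2 * c + 1)\<^sup>2 / 2 + (2 * c + 1)\<^sup>2 * (c - 3 / 2)\<^sup>2" for c :: real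
    by (simp add: field_simps power2_eq_square)
  ultimately have "(leg_length\<^sup>2)\<^sup>2 - (leg_sq t)\<^sup>2
      = (2 * cos t + 1)\<^sup>2 / 2 + (2 * cos t + 1)\<^sup>2 * (cos t - 3 / 2)\<^sup>2"
    by (simp only:)
  then show ?thesis
    by simp
qed

lemma leg_sq_le: "leg_sq t \<le> leg_length\<^sup>2"
proof -
  have "(leg_sq t)\<^sup>2 \<le> (leg_length\<^sup>2)\<^sup>2"
    using leg_sq_gap[of t] zero_le_power2[of "2 * cos t + 1"] by linarith
  then show ?thesis
    by (rule power2_le_imp_le) simp
qed

lemma sqrt_leg_sq_le: "sqrt (leg_sq t) \<le> leg_length"
  using leg_sq_le[of t] leg_length_bounds(1) by (intro real_le_lsqrt) auto

text \<open>At \<open>w = cis t\<close> the quotient is \<open>\<i> * tan (t / 2)\<close> and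
  \<open>w - 1 / w = 2 * \<i> * sin t\<close>; the identity
  \<open>sin t * tan (t / 2) = 1 - cos t\<close> turns the modulus into
  \<open>leg_sq\<close>.\<close>

lemma psi0_cis:
  assumes "0 \<le> t" "t < pi"
  shows "psi0 (cis t) = (\<i> - 1) * complex_of_real (sqrt (leg_sq t))"
    and "psi0 (cis (- t)) = (- 1 - \<i>) * complex_of_real (sqrt (leg_sq t))"
proof -
  define u where "u = t / 2"
  have t: "t = 2 * u"
    by (simp add: u_def)
  have cu: "cos u > 0" and tu: "tan u \<ge> 0"
    using assms by (auto simp: u_def intro!: cos_gt_zero_pi tan_pos_pi2_le)
  have quot: "(cis t - 1) / (cis t + 1) = \<i> * of_real (tan u)"
    "(cis (- t) - 1) / (cis (- t) + 1) = - \<i> * of_real (tan u)"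
  proof -
    have "cis t - 1 = 2 * \<i> * of_real (sin u) * cis u" "cis t + 1 = 2 * of_real (cos u) * cis u"
      "cis (- t) - 1 = - 2 * \<i> * of_real (sin u) * cis (- u)"
      "cis (- t) + 1 = 2 * of_real (cos u) * cis (- u)"
      unfolding t using sin_cos_squared_add[of u]
      by (auto simp: complex_eq_iff sin_double cos_double power2_eq_square)
    then show "(cis t - 1) / (cis t + 1) = \<i> * of_real (tan u)"
      "(cis (- t) - 1) / (cis (- t) + 1) = - \<i> * of_real (tan u)"
      using cu by (simp_all add: tan_def divide_simps)
  qed
  define r where "r = sqrt (tan u / 2)"
  have r: "r \<ge> 0" "2 * r\<^sup>2 = tan u"
    using tu by (auto simp: r_def)
  have root: "csqrt (\<i> * of_real (tan u)) = of_real r * (1 + \<i>)"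
    "csqrt (- \<i> * of_real (tan u)) = of_real r * (1 - \<i>)"
  proof -
    show "csqrt (\<i> * of_real (tan u)) = of_real r * (1 + \<i>)"
      using r by (intro csqrt_unique) (auto simp: complex_eq_iff power2_eq_square)
    show "csqrt (- \<i> * of_real (tan u)) = of_real r * (1 - \<i>)"
    proof (cases "r = 0")
      case True
      then show ?thesis
        using r by simp
    next
      case False
      then show ?thesis
        using r by (intro csqrt_unique) (auto simp: complex_eq_iff power2_eq_square)
    qed
  qed
  have len: "2 * sin t * r = sqrt (leg_sq t)"
  proof -
    have "sin t * tan u = 1 - cos t"
      using cu unfolding t sin_double cos_double_sin by (simp add: tan_def power2_eq_square)
    have "(2 * sin t * r)\<^sup>2 = 2 * sin t * (sin t * (2 * r\<^sup>2))"
      by (simp add: power2_eq_square)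
    also have "\<dots> = leg_sq t"
      unfolding r(2) \<open>sin t * tan u = 1 - cos t\<close> leg_sq_eq by simp
    finally have "sqrt (leg_sq t) = \<bar>2 * sin t * r\<bar>"
      by (metis real_sqrt_abs)
    then show ?thesis
      using r assms by (simp add: sin_ge_zero)
  qed
  have "psi0 (cis t) = (2 * \<i> * of_real (sin t)) * (of_real r * (1 + \<i>))"
    unfolding psi0_def quot root by (simp add: complex_eq_iff Re_divide Im_divide)
  also have "\<dots> = (\<i> - 1) * complex_of_real (2 * sin t * r)"
    by (simp add: complex_eq_iff)
  finally show "psi0 (cis t) = (\<i> - 1) * complex_of_real (sqrt (leg_sq t))"
    unfolding len .
  have "psi0 (cis (- t)) = (- 2 * \<i> * of_real (sin t)) * (of_real r * (1 - \<i>))"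
    unfolding psi0_def quot root by (simp add: complex_eq_iff Re_divide Im_divide)
  also have "\<dots> = (- 1 - \<i>) * complex_of_real (2 * sin t * r)"
    by (simp add: complex_eq_iff)
  finally show "psi0 (cis (- t)) = (- 1 - \<i>) * complex_of_real (sqrt (leg_sq t))"
    unfolding len .
qed

section \<open>Distinctness of the Fejer points\<close>

definition node_angle :: "nat \<Rightarrow> nat \<Rightarrow> real" where
  "node_angle n j = real (2 * j + n mod 2) * pi / real (n + 1)"

text \<open>The summand \<open>n mod 2\<close> merges the two parities: node angles are the
  multiples of \<open>pi / (n + 1)\<close> by integers of the parity of \<open>n\<close>.\<close>

lemma fejer_angle_eq:
  "fejer_angle n k = (if k \<le> n div 2 then node_angle n k
     else - node_angle n (2 * (n div 2) + 1 - k))"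
  by (auto simp: fejer_angle_def node_angle_def even_iff_mod_2_eq_zero odd_iff_mod_2_eq_one add.commute)

lemma node_angle_nonneg: "0 \<le> node_angle n j"
  by (simp add: node_angle_def)

lemma node_angle_pos: "0 < j \<or> odd n \<Longrightarrow> 0 < node_angle n j"
  by (auto simp: node_angle_def odd_iff_mod_2_eq_one intro!: divide_pos_pos mult_pos_pos)

lemma node_angle_less_pi:
  assumes "j \<le> n div 2"
  shows "node_angle n j < pi"
proof -
  have "2 * j + n mod 2 < n + 1"
    using assms by presburger
  then have "real (2 * j + n mod 2) < real (n + 1)"
    by (simp only: of_nat_less_iff)
  then show ?thesis
    by (simp add: node_angle_def divide_less_eq)
qed

lemma fejer_point_eq:
  assumes "k \<le> n"
  shows "fejer_point n k = (if k \<le> n div 2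
    then (\<i> - 1) * complex_of_real (sqrt (leg_sq (node_angle n k)))
    else (- 1 - \<i>) * complex_of_real (sqrt (leg_sq (node_angle n (2 * (n div 2) + 1 - k)))))"
  unfolding fejer_point_def fejer_angle_eq cis_conv_exp[symmetric]
  using assms by (auto intro!: psi0_cis node_angle_nonneg node_angle_less_pi)

text \<open>Mean and half-difference of two node angles are multiples of
  \<open>pi / (n + 1)\<close>, so a vanishing difference in \<open>leg_sq_diff\<close> would solve
  the excluded trigonometric equation.\<close>

lemma leg_sq_node_angle_neq:
  assumes "k < j" "j \<le> n div 2"
  shows "leg_sq (node_angle n j) \<noteq> leg_sq (node_angle n k)"
proof
  assume eq: "leg_sq (node_angle n j) = leg_sq (node_angle n k)"
  define \<sigma> \<tau> where "\<sigma> = (node_angle n j + node_angle n k) / 2"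
    and "\<tau> = (node_angle n j - node_angle n k) / 2"
  have \<sigma>: "\<sigma> = real (j + k + n mod 2) * pi / real (n + 1)"
    and \<tau>: "\<tau> = real (j - k) * pi / real (n + 1)"
    using assms(1) by (simp_all add: \<sigma>_def \<tau>_def node_angle_def of_nat_diff divide_simps)
      (simp_all add: algebra_simps)
  have j: "0 < node_angle n j" "node_angle n j < pi" "node_angle n k < pi" "0 \<le> node_angle n k"
    using assms by (auto intro: node_angle_pos node_angle_less_pi node_angle_nonneg)
  have "0 < \<tau>"
    using assms(1) unfolding \<tau> by (intro divide_pos_pos mult_pos_pos) auto
  moreover have "\<tau> < pi / 2" "0 < \<sigma>" "\<sigma> < pi"
    using j by (auto simp: \<tau>_def \<sigma>_def)
  ultimately have "cos \<sigma> \<noteq> cos (2 * \<sigma>) * cos \<tau>" "sin \<tau> \<noteq> 0"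
    using cos_ne_cos_double_mult_cos[OF _ \<sigma> _ _ \<tau>] sin_gt_zero[of \<tau>] by auto
  moreover have "2 * \<sigma> = node_angle n j + node_angle n k"
    unfolding \<sigma>_def by (simp only: mult_2 field_sum_of_halves)
  ultimately show False
    using leg_sq_diff[of "node_angle n j" "node_angle n k"] eq
    unfolding \<sigma>_def[symmetric] \<tau>_def[symmetric] by simp
qed

lemma inj_on_leg_sq_node_angle: "inj_on (\<lambda>j. leg_sq (node_angle n j)) {..n div 2}"
proof (rule inj_onI)
  fix j k
  assume "j \<in> {..n div 2}" "k \<in> {..n div 2}" "leg_sq (node_angle n j) = leg_sq (node_angle n k)"
  then show "j = k"
    using leg_sq_node_angle_neq[of j k n] leg_sq_node_angle_neq[of k j n]
    by (cases j k rule: linorder_cases) auto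
qed

lemma fejer_point_inj: "inj_on (fejer_point n) {..n}"
proof (rule inj_onI)
  let ?m = "n div 2"
  let ?r = "\<lambda>j. sqrt (leg_sq (node_angle n j))"
  have r_inj: "j = k" if "?r j = ?r k" "j \<le> ?m" "k \<le> ?m" for j k
    using that inj_onD[OF inj_on_leg_sq_node_angle[of n], of j k] by simp
  \<comment> \<open>The corner 0 is a node only for even \<open>n\<close>, and then only with index
    0 on the upper leg; so the two legs share no node.\<close>
  have lower: "2 * ?m + 1 - j \<le> ?m" "?r (2 * ?m + 1 - j) > 0" if "\<not> j \<le> ?m" "j \<le> n" for j
  proof -
    show "2 * ?m + 1 - j \<le> ?m"
      using that by simp
    moreover have "0 < 2 * ?m + 1 - j \<or> odd n"
      using that by presburger
    ultimately show "?r (2 * ?m + 1 - j) > 0"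
      by (simp add: leg_sq_pos node_angle_pos node_angle_less_pi)
  qed
  have upper: "?r j \<ge> 0" if "j \<le> ?m" for j
    using that by (simp add: leg_sq_nonneg node_angle_nonneg node_angle_less_pi less_imp_le)
  fix j k assume jk: "j \<in> {..n}" "k \<in> {..n}" "fejer_point n j = fejer_point n k"
  show "j = k"
  proof (cases "j \<le> ?m"; cases "k \<le> ?m")
    assume "j \<le> ?m" "k \<le> ?m"
    then show ?thesis
      using jk by (intro r_inj) (auto simp: fejer_point_eq complex_eq_iff)
  next
    assume *: "\<not> j \<le> ?m" "\<not> k \<le> ?m"
    then have "2 * ?m + 1 - j = 2 * ?m + 1 - k"
      using jk by (intro r_inj lower) (auto simp: fejer_point_eq complex_eq_iff)
    moreover have "j \<le> 2 * ?m + 1" "k \<le> 2 * ?m + 1"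
      using jk(1,2) by auto
    ultimately show ?thesis
      by linarith
  next
    assume *: "j \<le> ?m" "\<not> k \<le> ?m"
    then show ?thesis
      using jk upper[of j] lower(2)[of k] by (auto simp: fejer_point_eq complex_eq_iff)
  next
    assume *: "\<not> j \<le> ?m" "k \<le> ?m"
    then show ?thesis
      using jk upper[of k] lower(2)[of j] by (auto simp: fejer_point_eq complex_eq_iff)
  qed
qed

lemma leg_in_gamma0: "0 \<le> x \<Longrightarrow> x \<le> leg_length \<Longrightarrow> (\<i> - 1) * complex_of_real x \<in> gamma0"
  "0 \<le> x \<Longrightarrow> x \<le> leg_length \<Longrightarrow> (- 1 - \<i>) * complex_of_real x \<in> gamma0"
  unfolding gamma0_def leg_length_def by auto

lemma fejer_point_in_gamma0:
  assumes "k \<le> n"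
  shows "fejer_point n k \<in> gamma0"
proof -
  have "0 \<le> sqrt (leg_sq (node_angle n j))" if "j \<le> n div 2" for j
    using that by (simp add: leg_sq_nonneg node_angle_nonneg node_angle_less_pi less_imp_le)
  moreover have "2 * (n div 2) + 1 - k \<le> n div 2" if "\<not> k \<le> n div 2"
    using that assms by simp
  ultimately show ?thesis
    unfolding fejer_point_eq[OF assms] by (auto intro!: leg_in_gamma0 sqrt_leg_sq_le)
qed

section \<open>Lower bounds for the Lebesgue constant from its nodes\<close>

lemma compact_gamma0: "compact gamma0"
proof -
  have "gamma0 = (\<lambda>x. (- 1 + \<i>) * complex_of_real x) ` {0..27 powr (1/4) / sqrt 2}
      \<union> (\<lambda>x. (- 1 - \<i>) * complex_of_real x) ` {0..27 powr (1/4) / sqrt 2}"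
    unfolding gamma0_def by blast
  also have "compact \<dots>"
    by (intro compact_Un compact_continuous_image compact_Icc continuous_on_mult
        continuous_on_const continuous_on_of_real continuous_on_id)
  finally show ?thesis .
qed

lemma lebesgue_function_le_constant:
  assumes "x \<in> gamma0"
  shows "lebesgue_function n (fejer_point n) x \<le> lebesgue_constant gamma0 n (fejer_point n)"
proof -
  have "bdd_above (lebesgue_function n (fejer_point n) ` gamma0)"
    by (intro bounded_imp_bdd_above compact_imp_bounded compact_continuous_image
        continuous_on_lebesgue_function compact_gamma0)
  then show ?thesis
    using assms lebesgue_constant_eq(1)[OF compact_gamma0 fejer_point_inj] fejer_point_in_gamma0
    by (auto simp: image_subset_iff intro: cSUP_upper)
qed

text \<open>The Lebesgue function is 1 at every node. The bound supplies the sign of the constant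
  and settles small \<open>n\<close>.\<close>

lemma lebesgue_constant_ge_1: "1 \<le> lebesgue_constant gamma0 n (fejer_point n)"
proof -
  have "lebesgue_function n (fejer_point n) (fejer_point n 0) = (\<Sum>j\<le>n. if j = 0 then 1 else 0)"
    unfolding lebesgue_function_def
    by (intro sum.cong) (auto simp: lagrange_basis_node[OF fejer_point_inj])
  then show ?thesis
    using lebesgue_function_le_constant[OF fejer_point_in_gamma0[of 0 n], of n] by simp
qed

text \<open>Apply the Bernstein estimate on the upper leg to the Lagrange polynomial that is 1 at one
  node and 0 at the other.\<close>

lemma lebesgue_constant_ge_inverse_gap:
  assumes n: "n > 0" and jk: "j \<le> n div 2" "k \<le> n div 2" "j \<noteq> k"
    and s: "leg_length * (1 + cos s) / 2 = sqrt (leg_sq (node_angle n j))"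
    and t: "leg_length * (1 + cos t) / 2 = sqrt (leg_sq (node_angle n k))"
  shows "1 \<le> 3 * real n * lebesgue_constant gamma0 n (fejer_point n) * \<bar>s - t\<bar>"
proof -
  let ?z = "fejer_point n"
  \<comment> \<open>The map \<open>u \<mapsto> c * (1 + u)\<close> sends \<open>[-1, 1]\<close> onto
    the upper leg, -1 to the corner and 1 to the tip.\<close>
  define c where "c = (\<i> - 1) * complex_of_real (leg_length / 2)"
  define P where "P = pcompose (lagrange_poly n ?z j) [:c, c:]"
  have jk': "j \<le> n" "k \<le> n"
    using jk by auto
  have P: "poly P (of_real u)
      = lagrange_basis n ?z j ((\<i> - 1) * complex_of_real (leg_length * (1 + u) / 2))" for u
  proof -
    have "poly [:c, c:] (of_real u) = (\<i> - 1) * complex_of_real (leg_length * (1 + u) / 2)"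
      by (simp add: c_def algebra_simps add_divide_distrib)
    then show ?thesis
      unfolding P_def poly_pcompose poly_lagrange_poly by (simp only:)
  qed
  have "degree P \<le> n"
    using degree_pcompose_le[of "lagrange_poly n ?z j" "[:c, c:]"] degree_lagrange_poly[OF jk'(1), of ?z]
    by (auto simp: P_def split: if_splits)
  moreover have "cmod (poly P (of_real u)) \<le> lebesgue_constant gamma0 n ?z" if u: "\<bar>u\<bar> \<le> 1" for u
  proof -
    have "leg_length * (1 + u) / 2 \<le> leg_length * 2 / 2"
      using u leg_length_bounds(1) by (intro divide_right_mono mult_left_mono) auto
    then have x: "(\<i> - 1) * complex_of_real (leg_length * (1 + u) / 2) \<in> gamma0" (is "?x \<in> _")
      using u leg_length_bounds(1) by (intro leg_in_gamma0) auto
    have "cmod (poly P (of_real u)) \<le> lebesgue_function n ?z ?x"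
      unfolding P lebesgue_function_def
      using jk' by (intro member_le_sum) auto
    also have "\<dots> \<le> lebesgue_constant gamma0 n ?z"
      using x by (rule lebesgue_function_le_constant)
    finally show ?thesis .
  qed
  ultimately have "cmod (poly P (of_real (cos s)) - poly P (of_real (cos t)))
      \<le> 3 * real n * lebesgue_constant gamma0 n ?z * \<bar>s - t\<bar>"
    using n by (intro Bernstein_cos_lipschitz)
  moreover have "poly P (of_real (cos s)) = lagrange_basis n ?z j (?z j)"
    "poly P (of_real (cos t)) = lagrange_basis n ?z j (?z k)"
    unfolding P s t using jk jk' by (simp_all add: fejer_point_eq)
  ultimately show ?thesis
    using jk(3) lagrange_basis_node[OF fejer_point_inj jk'(1)] jk' by simp
qed

subsection \<open>Nearly coinciding nodes\<close>

lemma sin_ge_half: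
  assumes "0 \<le> x" "x \<le> pi / 2"
  shows "x / 2 \<le> sin (x::real)"
proof (cases "x \<le> pi / 3")
  case True
  have "sin 0 - 0 / 2 \<le> sin x - x / 2"
  proof (rule DERIV_nonneg_imp_nondecreasing[OF assms(1)])
    fix y :: real assume y: "0 \<le> y" "y \<le> x"
    have "cos (pi / 3) \<le> cos y"
      using y True by (intro cos_monotone_0_pi_le) auto
    then show "\<exists>d. ((\<lambda>y. sin y - y / 2) has_real_derivative d) (at y) \<and> 0 \<le> d"
      by (intro exI[of _ "cos y - 1 / 2"] conjI) (auto simp: cos_60 intro!: derivative_eq_intros)
  qed
  then show ?thesis
    by simp
next
  case False
  have "sqrt 3 / 2 \<le> sin x"
    using False assms sin_monotone_2pi_le[of "pi / 3" x] by (simp add: sin_60)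
  \<comment> \<open>Rational bounds for the chain
    \<open>x / 2 \<le> pi / 4 \<le> 17 / 20 \<le> sqrt 3 / 2\<close>.\<close>
  moreover have "17 / 10 \<le> sqrt 3"
    by (rule real_le_rsqrt) (simp add: power2_eq_square)
  moreover have "pi \<le> 17 / 5"
    using pi_approx by simp
  ultimately show ?thesis
    using assms(2) by simp
qed

lemma one_minus_cos_eq: "1 - cos x = 2 * (sin (x / 2))\<^sup>2" for x :: real
proof -
  have "cos x = 1 - 2 * (sin (x / 2))\<^sup>2"
    using cos_double_sin[of "x / 2"] by simp
  then show ?thesis
    by simp
qed

lemma one_minus_cos_le: "1 - cos x \<le> x\<^sup>2 / 2" for x :: real
proof -
  have "(sin (x / 2))\<^sup>2 \<le> (x / 2)\<^sup>2"
    unfolding abs_le_square_iff[symmetric] by (rule abs_sin_x_le_abs_x)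
  then show ?thesis
    unfolding one_minus_cos_eq by (simp add: power_divide)
qed

lemma one_minus_cos_ge:
  assumes "0 \<le> x" "x \<le> pi"
  shows "x\<^sup>2 / 8 \<le> 1 - cos x"
proof -
  have "(x / 4)\<^sup>2 \<le> (sin (x / 2))\<^sup>2"
    using sin_ge_half[of "x / 2"] assms by (intro power_mono) auto
  then show ?thesis
    unfolding one_minus_cos_eq by (simp add: power_divide)
qed

lemma cos_diff_le: "\<bar>cos x - cos y\<bar> \<le> \<bar>x + y\<bar> * \<bar>x - y\<bar> / 2" for x y :: real
proof -
  have "\<bar>cos x - cos y\<bar> = 2 * (\<bar>sin ((x + y) / 2)\<bar> * \<bar>sin ((y - x) / 2)\<bar>)"
    unfolding cos_diff_cos by (simp add: abs_mult)
  also have "\<dots> \<le> 2 * (\<bar>(x + y) / 2\<bar> * \<bar>(y - x) / 2\<bar>)"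
    by (intro mult_left_mono mult_mono abs_sin_x_le_abs_x) auto
  also have "\<dots> = \<bar>x + y\<bar> * \<bar>x - y\<bar> / 2"
    by (simp add: abs_divide abs_minus_commute)
  finally show ?thesis .
qed

lemma cos_diff_ge:
  assumes "0 \<le> x" "x \<le> pi / 2" "0 \<le> y" "y \<le> pi / 2"
  shows "(x + y) * \<bar>x - y\<bar> / 8 \<le> \<bar>cos x - cos y\<bar>"
proof -
  have "\<bar>x - y\<bar> / 4 \<le> \<bar>sin ((y - x) / 2)\<bar>"
  proof (cases "x \<le> y")
    case True
    then show ?thesis
      using sin_ge_half[of "(y - x) / 2"] assms by auto
  next
    case False
    have "sin ((y - x) / 2) = - sin ((x - y) / 2)"
      by (metis minus_diff_eq minus_divide_left sin_minus)
    then show ?thesis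
      using sin_ge_half[of "(x - y) / 2"] assms False by auto
  qed
  moreover have "(x + y) / 4 \<le> sin ((x + y) / 2)"
    using sin_ge_half[of "(x + y) / 2"] assms by auto
  ultimately have "2 * ((x + y) / 4 * (\<bar>x - y\<bar> / 4)) \<le> 2 * (\<bar>sin ((x + y) / 2)\<bar> * \<bar>sin ((y - x) / 2)\<bar>)"
    using assms by (intro mult_left_mono mult_mono) auto
  also have "\<dots> = \<bar>cos x - cos y\<bar>"
    unfolding cos_diff_cos by (simp add: abs_mult)
  finally show ?thesis
    by (simp add: algebra_simps)
qed

lemma sin_ge_one_half:
  assumes "pi / 6 \<le> x" "x \<le> 5 * pi / 6"
  shows "1 / 2 \<le> sin (x::real)"
proof (cases "x \<le> pi / 2")
  case True
  then show ?thesis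
    using sin_monotone_2pi_le[of "pi / 6" x] assms by (simp add: sin_30)
next
  case False
  then have "sin (pi / 6) \<le> sin (pi - x)"
    using assms by (intro sin_monotone_2pi_le) auto
  then show ?thesis
    by (simp add: sin_30)
qed

section \<open>The Chebyshev angle near the tip of a leg\<close>

lemma leg_sq_ge_1:
  assumes "pi / 2 \<le> x" "x \<le> 5 * pi / 6"
  shows "1 \<le> leg_sq x"
proof -
  have "1 / 2 \<le> sin x"
    using assms by (intro sin_ge_one_half) auto
  moreover have "cos x \<le> 0"
    using assms cos_monotone_0_pi_le[of "pi / 2" x] by simp
  ultimately have "1 * 1 \<le> (2 * sin x) * (1 - cos x)"
    by (intro mult_mono) auto
  then show ?thesis
    by (simp add: leg_sq_eq)
qed

text \<open>The Chebyshev angle of the point with circle angle \<open>x\<close>: the leg is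
  parametrized by \<open>leg_length * (1 + cos s) / 2\<close>, with \<open>s = 0\<close> at the
  tip.\<close>

definition leg_angle :: "real \<Rightarrow> real" where
  "leg_angle x = arccos (2 * sqrt (leg_sq x) / leg_length - 1)"

text \<open>The hypothesis places the point in the outer half of the leg, as
  \<open>leg_length \<le> 2\<close>; hence the bound \<open>pi / 2\<close>, which
  \<open>cos_diff_ge\<close> needs.\<close>

lemma leg_angle:
  assumes "1 \<le> leg_sq x"
  shows "cos (leg_angle x) = 2 * sqrt (leg_sq x) / leg_length - 1"
    and "leg_length * (1 + cos (leg_angle x)) / 2 = sqrt (leg_sq x)"
    and "0 \<le> leg_angle x" "leg_angle x \<le> pi / 2"
proof -
  have "1 \<le> sqrt (leg_sq x)" and le: "sqrt (leg_sq x) \<le> leg_length"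
    using assms sqrt_leg_sq_le by auto
  then have "leg_length \<le> 2 * sqrt (leg_sq x)"
    using leg_length_bounds by linarith
  then have y: "0 \<le> 2 * sqrt (leg_sq x) / leg_length - 1" "2 * sqrt (leg_sq x) / leg_length - 1 \<le> 1"
    using leg_length_bounds le by (simp_all add: field_simps)
  then show c: "cos (leg_angle x) = 2 * sqrt (leg_sq x) / leg_length - 1"
    unfolding leg_angle_def by (intro cos_arccos) auto
  show "leg_length * (1 + cos (leg_angle x)) / 2 = sqrt (leg_sq x)"
    unfolding c using leg_length_bounds by simp
  show "0 \<le> leg_angle x" "leg_angle x \<le> pi / 2"
    unfolding leg_angle_def using y by (intro arccos_lbound arccos_le_pi2; linarith)+
qed

text \<open>The gap of \<open>leg_sq\<close> below its maximum is at least a multiple of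
  \<open>(2 * cos x + 1) ^ 2\<close> and at most a multiple of the squared Chebyshev angle.
  Enlarging 18 to the square 25 gives the constant 5.\<close>

lemma leg_angle_ge:
  assumes "1 \<le> leg_sq x"
  shows "\<bar>2 * cos x + 1\<bar> / 5 \<le> leg_angle x"
proof -
  let ?X = "leg_length" and ?r = "sqrt (leg_sq x)" and ?c = "(2 * cos x + 1)\<^sup>2"
  have X: "1 \<le> ?X" "?X\<^sup>2 \<le> 3" "?r \<le> ?X" "1 \<le> ?r" "?r\<^sup>2 = leg_sq x"
    using leg_length_bounds sqrt_leg_sq_le assms by auto
  have "?c / 2 \<le> (?X\<^sup>2 - leg_sq x) * (?X\<^sup>2 + leg_sq x)"
    using leg_sq_gap[of x] by (simp add: algebra_simps power2_eq_square)
  also have "\<dots> \<le> (?X\<^sup>2 - leg_sq x) * 6"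
    using leg_sq_le[of x] X by (intro mult_left_mono) auto
  finally have gap: "?c / 12 \<le> ?X\<^sup>2 - leg_sq x"
    by simp
  also have "\<dots> = (?X - ?r) * (?X + ?r)"
    using X by (simp add: algebra_simps power2_eq_square)
  also have "\<dots> \<le> (?X - ?r) * (2 * ?X)"
    using X by (intro mult_left_mono) auto
  also have "\<dots> = ?X\<^sup>2 * (1 - cos (leg_angle x))"
    unfolding leg_angle(1)[OF assms] using X by (simp add: field_simps power2_eq_square)
  also have "\<dots> \<le> 3 * ((leg_angle x)\<^sup>2 / 2)"
    using X one_minus_cos_le by (intro mult_mono) auto
  finally have "?c \<le> 18 * (leg_angle x)\<^sup>2"
    by simp
  also have "\<dots> \<le> 25 * (leg_angle x)\<^sup>2"
    by simp
  also have "\<dots> = (5 * leg_angle x)\<^sup>2"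
    by (simp add: power2_eq_square)
  finally have "\<bar>2 * cos x + 1\<bar> \<le> \<bar>5 * leg_angle x\<bar>"
    by (simp only: abs_le_square_iff)
  then show ?thesis
    using leg_angle(3)[OF assms] by simp
qed

text \<open>The cosine is quadratic at the tip, so a difference of angles is controlled only after
  multiplication by an angle.\<close>

lemma leg_angle_diff:
  assumes "1 \<le> leg_sq x" "1 \<le> leg_sq y"
  shows "leg_angle x * \<bar>leg_angle x - leg_angle y\<bar> \<le> 8 * \<bar>leg_sq x - leg_sq y\<bar>"
proof -
  let ?X = "leg_length" and ?r = "sqrt (leg_sq x)" and ?r' = "sqrt (leg_sq y)"
  have X: "1 \<le> ?X" "1 \<le> ?r" "1 \<le> ?r'" "?r\<^sup>2 = leg_sq x" "?r'\<^sup>2 = leg_sq y"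
    using leg_length_bounds assms by auto
  have "leg_angle x * \<bar>leg_angle x - leg_angle y\<bar>
      \<le> (leg_angle x + leg_angle y) * \<bar>leg_angle x - leg_angle y\<bar>"
    using leg_angle(3)[OF assms(2)] by (intro mult_right_mono) auto
  also have "\<dots> \<le> 8 * \<bar>cos (leg_angle x) - cos (leg_angle y)\<bar>"
    using cos_diff_ge[OF leg_angle(3,4)[OF assms(1)] leg_angle(3,4)[OF assms(2)]] by simp
  also have "\<bar>cos (leg_angle x) - cos (leg_angle y)\<bar> \<le> \<bar>leg_sq x - leg_sq y\<bar>"
  proof -
    have "cos (leg_angle x) - cos (leg_angle y) = 2 * (?r - ?r') / ?X"
      unfolding leg_angle(1)[OF assms(1)] leg_angle(1)[OF assms(2)]
      by (simp add: diff_divide_distrib algebra_simps)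
    then have "\<bar>cos (leg_angle x) - cos (leg_angle y)\<bar> = 2 * \<bar>?r - ?r'\<bar> / ?X"
      using X(1) by (simp only: abs_mult abs_divide abs_numeral)
    also have "\<dots> \<le> 2 * \<bar>?r - ?r'\<bar> / 1"
      using X(1) by (intro divide_left_mono) auto
    also have "\<dots> \<le> (?r + ?r') * \<bar>?r - ?r'\<bar>"
      unfolding div_by_1 using X(2,3) by (intro mult_right_mono) linarith+
    also have "\<dots> = \<bar>(?r + ?r') * (?r - ?r')\<bar>"
      using X by (simp add: abs_mult)
    also have "(?r + ?r') * (?r - ?r') = leg_sq x - leg_sq y"
      using X(4,5) by (simp add: algebra_simps power2_eq_square)
    finally show ?thesis .
  qed
  finally show ?thesis
    by simp
qed

text \<open>The parameter \<open>2 * pi / 3\<close> is sent to the tip of the leg, where \<open>leg_sq\<close> folds. For the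
  centre \<open>2 * pi / 3 - \<epsilon>\<close>, the two preimages of one point lie at distance \<open>\<tau>\<^sub>0\<close>, of order
  \<open>sqrt \<epsilon>\<close>, from it; moving \<open>\<tau>\<^sub>0\<close> by at most \<open>6 * \<epsilon>\<close> (one grid step) separates the images
  by \<open>O(\<epsilon>\<^sup>2)\<close> only.\<close>

lemma fold_near_tip:
  fixes \<epsilon> :: real
  assumes \<epsilon>: "0 < \<epsilon>" "\<epsilon> \<le> 1 / 1000"
  defines "\<sigma> \<equiv> 2 * pi / 3 - \<epsilon>"
  obtains \<tau>\<^sub>0 where "0 < \<tau>\<^sub>0" "\<And>\<tau>. \<tau>\<^sub>0 \<le> \<tau> \<Longrightarrow> \<tau> \<le> \<tau>\<^sub>0 + 6 * \<epsilon> \<Longrightarrow>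
    pi / 2 \<le> \<sigma> - \<tau> \<and> \<sigma> + \<tau> \<le> 5 * pi / 6 \<and>
    \<bar>leg_angle (\<sigma> + \<tau>) - leg_angle (\<sigma> - \<tau>)\<bar> \<le> 300000 * (\<epsilon> * sqrt \<epsilon>)"
proof -
  have pi: "3 < pi" "pi < 4"
    using pi_gt3 pi_less_4 by auto
  have sq: "sqrt \<epsilon> * sqrt \<epsilon> = \<epsilon>" "0 < sqrt \<epsilon>"
    using \<epsilon> by auto
  have "(sqrt \<epsilon>)\<^sup>2 \<le> (1 / 30)\<^sup>2"
    using \<epsilon> by (simp add: power2_eq_square)
  then have sq30: "sqrt \<epsilon> \<le> 1 / 30"
    by (rule power2_le_imp_le) simp
  have \<epsilon>_sq: "\<epsilon> \<le> sqrt \<epsilon> / 30"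
    using mult_left_mono[OF sq30, of "sqrt \<epsilon>"] sq by simp
  have c2: "cos (2 * \<sigma>) \<le> - 1 / 2" "- 1 \<le> cos (2 * \<sigma>)"
  proof -
    have "cos (pi / 3) \<le> cos (pi / 3 - 2 * \<epsilon>)"
      using \<epsilon> pi by (intro cos_monotone_0_pi_le) auto
    moreover have "2 * \<sigma> = (pi / 3 - 2 * \<epsilon>) + pi"
      by (simp add: \<sigma>_def)
    then have "cos (2 * \<sigma>) = - cos (pi / 3 - 2 * \<epsilon>)"
      by (simp only: cos_periodic_pi)
    ultimately show "cos (2 * \<sigma>) \<le> - 1 / 2"
      by (simp add: cos_60)
  qed simp
  \<comment> \<open>The value of \<open>cos \<tau>\<close> for which the two points with centre
    \<sigma> coincide, by \<open>leg_sq_diff\<close>.\<close>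
  define y where "y = cos \<sigma> / cos (2 * \<sigma>)"
  have y: "cos \<sigma> = cos (2 * \<sigma>) * y"
    using c2 by (simp add: y_def)
  \<comment> \<open>This difference equals \<open>cos (2 * \<sigma>) * (y - 1)\<close>. Its factor
    \<open>sin (3 * \<epsilon> / 2)\<close> shows that \<open>1 - y\<close> is of exact order
    \<epsilon>.\<close>
  have D: "cos \<sigma> - cos (2 * \<sigma>) = 2 * sin (3 * \<epsilon> / 2) * sin (\<sigma> / 2)"
  proof -
    have "cos \<sigma> - cos (2 * \<sigma>) = 2 * sin ((\<sigma> + 2 * \<sigma>) / 2) * sin ((2 * \<sigma> - \<sigma>) / 2)"
      by (rule cos_diff_cos)
    moreover have "(\<sigma> + 2 * \<sigma>) / 2 = pi - 3 * \<epsilon> / 2" "(2 * \<sigma> - \<sigma>) / 2 = \<sigma> / 2"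
      by (simp_all add: \<sigma>_def field_simps)
    ultimately show ?thesis
      by (simp only: sin_pi_minus)
  qed
  have s1: "3 * \<epsilon> / 4 \<le> sin (3 * \<epsilon> / 2)" "sin (3 * \<epsilon> / 2) \<le> 3 * \<epsilon> / 2"
    using sin_ge_half[of "3 * \<epsilon> / 2"] sin_x_le_x[of "3 * \<epsilon> / 2"] \<epsilon> pi by auto
  have s2: "1 / 2 \<le> sin (\<sigma> / 2)" "sin (\<sigma> / 2) \<le> 1"
    using sin_ge_one_half[of "\<sigma> / 2"] \<epsilon> pi by (auto simp: \<sigma>_def)
  have prod: "3 * \<epsilon> / 4 * (1 / 2) \<le> sin (3 * \<epsilon> / 2) * sin (\<sigma> / 2)"
    "sin (3 * \<epsilon> / 2) * sin (\<sigma> / 2) \<le> 3 * \<epsilon> / 2 * 1"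
    using s1 s2 \<epsilon> by (intro mult_mono; simp)+
  have eqy: "(1 - y) * (- cos (2 * \<sigma>)) = 2 * (sin (3 * \<epsilon> / 2) * sin (\<sigma> / 2))"
    using D y by (simp add: algebra_simps)
  have y1: "0 \<le> 1 - y"
  proof (rule ccontr)
    assume "\<not> 0 \<le> 1 - y"
    then have "(1 - y) * (- cos (2 * \<sigma>)) \<le> 0"
      using c2 by (intro mult_nonpos_nonneg) auto
    then show False
      using eqy prod \<epsilon> by linarith
  qed
  have y2: "1 - y \<le> 6 * \<epsilon>"
  proof -
    have "(1 - y) * (1 / 2) \<le> (1 - y) * (- cos (2 * \<sigma>))"
      using y1 c2 by (intro mult_left_mono) auto
    also have "\<dots> \<le> 2 * (3 * \<epsilon> / 2 * 1)"
      unfolding eqy using prod by (intro mult_left_mono) auto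
    finally show ?thesis
      by simp
  qed
  have y3: "3 * \<epsilon> / 4 \<le> 1 - y"
  proof -
    have "(1 - y) * (- cos (2 * \<sigma>)) \<le> (1 - y) * 1"
      using y1 c2 by (intro mult_left_mono) auto
    then have "2 * (3 * \<epsilon> / 4 * (1 / 2)) \<le> (1 - y) * 1"
      unfolding eqy using prod(1) by linarith
    then show ?thesis
      by simp
  qed
  define \<tau>\<^sub>0 where "\<tau>\<^sub>0 = arccos y"
  have \<tau>\<^sub>0: "cos \<tau>\<^sub>0 = y" "0 \<le> \<tau>\<^sub>0" "\<tau>\<^sub>0 \<le> pi"
    using y1 y2 \<epsilon> by (auto simp: \<tau>\<^sub>0_def intro!: cos_arccos arccos_lbound arccos_ubound)
  have "\<tau>\<^sub>0\<^sup>2 \<le> 48 * \<epsilon>"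
    using one_minus_cos_ge[OF \<tau>\<^sub>0(2,3)] y2 \<tau>\<^sub>0(1) by simp
  also have "\<dots> \<le> (7 * sqrt \<epsilon>)\<^sup>2"
    using \<epsilon> by (simp add: power_mult_distrib)
  finally have \<tau>\<^sub>0_le: "\<tau>\<^sub>0 \<le> 7 * sqrt \<epsilon>"
    using sq by (intro power2_le_imp_le[of \<tau>\<^sub>0]) auto
  have "(sqrt \<epsilon>)\<^sup>2 \<le> \<tau>\<^sub>0\<^sup>2"
    using one_minus_cos_le[of \<tau>\<^sub>0] y3 \<tau>\<^sub>0(1) \<epsilon> by simp
  then have \<tau>\<^sub>0_ge: "sqrt \<epsilon> \<le> \<tau>\<^sub>0"
    using \<tau>\<^sub>0(2) by (rule power2_le_imp_le)
  show thesis
  proof (rule that)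
    show "0 < \<tau>\<^sub>0"
      using \<tau>\<^sub>0_ge sq by linarith
    fix \<tau> assume \<tau>: "\<tau>\<^sub>0 \<le> \<tau>" "\<tau> \<le> \<tau>\<^sub>0 + 6 * \<epsilon>"
    have \<tau>_le: "\<tau> \<le> 8 * sqrt \<epsilon>"
      using \<tau> \<tau>\<^sub>0_le \<epsilon>_sq sq by linarith
    have \<tau>_pos: "0 < \<tau>"
      using \<tau> \<tau>\<^sub>0_ge sq by linarith
    have range: "pi / 2 \<le> \<sigma> - \<tau>" "\<sigma> + \<tau> \<le> 5 * pi / 6"
      using \<tau>_le sq30 \<epsilon> pi by (simp_all add: \<sigma>_def)
    have ge1: "1 \<le> leg_sq (\<sigma> + \<tau>)" "1 \<le> leg_sq (\<sigma> - \<tau>)"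
      using range \<tau>_pos by (auto intro!: leg_sq_ge_1)
    \<comment> \<open>Here \<open>sin \<tau>\<close> contributes \<open>sqrt \<epsilon>\<close>, and
      the difference of cosines contributes \<open>\<epsilon> * sqrt \<epsilon>\<close>.\<close>
    have close: "\<bar>leg_sq (\<sigma> + \<tau>) - leg_sq (\<sigma> - \<tau>)\<bar> \<le> 1536 * \<epsilon>\<^sup>2"
    proof -
      have arg: "((\<sigma> + \<tau>) - (\<sigma> - \<tau>)) / 2 = \<tau>" "(\<sigma> + \<tau>) + (\<sigma> - \<tau>) = 2 * \<sigma>"
        "2 * \<sigma> / 2 = \<sigma>"
        by simp_all
      have "leg_sq (\<sigma> + \<tau>) - leg_sq (\<sigma> - \<tau>) = 4 * sin \<tau> * (cos \<sigma> - cos (2 * \<sigma>) * cos \<tau>)"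
        using leg_sq_diff[of "\<sigma> + \<tau>" "\<sigma> - \<tau>"] unfolding arg .
      also have "\<dots> = 4 * sin \<tau> * (cos (2 * \<sigma>) * (cos \<tau>\<^sub>0 - cos \<tau>))"
        using y \<tau>\<^sub>0(1) by (simp add: algebra_simps)
      finally have "\<bar>leg_sq (\<sigma> + \<tau>) - leg_sq (\<sigma> - \<tau>)\<bar>
          = 4 * \<bar>sin \<tau>\<bar> * (\<bar>cos (2 * \<sigma>)\<bar> * \<bar>cos \<tau>\<^sub>0 - cos \<tau>\<bar>)"
        by (simp add: abs_mult)
      also have "\<dots> \<le> 4 * (8 * sqrt \<epsilon>) * (1 * (16 * sqrt \<epsilon> * (6 * \<epsilon>) / 2))"
      proof (intro mult_mono)
        show "\<bar>sin \<tau>\<bar> \<le> 8 * sqrt \<epsilon>"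
          using abs_sin_x_le_abs_x[of \<tau>] \<tau>_le \<tau>_pos by simp
        have "\<bar>\<tau>\<^sub>0 + \<tau>\<bar> * \<bar>\<tau>\<^sub>0 - \<tau>\<bar> \<le> 16 * sqrt \<epsilon> * (6 * \<epsilon>)"
          using \<tau> \<tau>_le \<tau>_pos \<tau>\<^sub>0(2) by (intro mult_mono) auto
        then show "\<bar>cos \<tau>\<^sub>0 - cos \<tau>\<bar> \<le> 16 * sqrt \<epsilon> * (6 * \<epsilon>) / 2"
          using cos_diff_le[of \<tau>\<^sub>0 \<tau>] by linarith
      qed (use sq \<epsilon> in auto)
      also have "\<dots> = 1536 * \<epsilon>\<^sup>2"
        using sq(1) by (simp add: power2_eq_square)
      finally show ?thesis .
    qed
    have "sqrt \<epsilon> / 20 \<le> leg_angle (\<sigma> + \<tau>)"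
    proof -
      \<comment> \<open>The distance of \<open>\<sigma> + \<tau>\<close> beyond the fold at
        \<open>2 * pi / 3\<close>; it stays of order \<open>sqrt \<epsilon>\<close>, since
        \<epsilon> is much smaller.\<close>
      define d where "d = \<tau> - \<epsilon>"
      have d: "sqrt \<epsilon> / 2 \<le> d" "0 \<le> d" "d \<le> pi / 6"
        using \<tau> \<tau>\<^sub>0_ge \<epsilon>_sq sq range by (auto simp: d_def \<sigma>_def)
      have \<alpha>: "\<sigma> + \<tau> = 2 * pi / 3 + d"
        by (simp add: \<sigma>_def d_def)
      have "cos (2 * pi / 3) - cos (\<sigma> + \<tau>)
          = 2 * sin ((2 * pi / 3 + (\<sigma> + \<tau>)) / 2) * sin ((\<sigma> + \<tau> - 2 * pi / 3) / 2)"
        by (rule cos_diff_cos)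
      also have "\<dots> \<ge> 2 * (1 / 2) * (d / 4)"
      proof (intro mult_mono)
        show "1 / 2 \<le> sin ((2 * pi / 3 + (\<sigma> + \<tau>)) / 2)"
          unfolding \<alpha> using d by (intro sin_ge_one_half) auto
        show "d / 4 \<le> sin ((\<sigma> + \<tau> - 2 * pi / 3) / 2)"
          unfolding \<alpha> using d sin_ge_half[of "d / 2"] by simp
        have "0 \<le> sin ((2 * pi / 3 + (\<sigma> + \<tau>)) / 2)"
          unfolding \<alpha> using d by (intro sin_ge_zero) auto
        then show "0 \<le> 2 * sin ((2 * pi / 3 + (\<sigma> + \<tau>)) / 2)"
          by simp
      qed (use d in auto)
      finally have "d / 2 \<le> \<bar>2 * cos (\<sigma> + \<tau>) + 1\<bar>"
        unfolding cos_120 by linarith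
      then have "d / 2 / 5 \<le> \<bar>2 * cos (\<sigma> + \<tau>) + 1\<bar> / 5"
        by (rule divide_right_mono) simp
      also note leg_angle_ge[OF ge1(1)]
      finally show ?thesis
        using d(1) by simp
    qed
    then have "sqrt \<epsilon> / 20 * \<bar>leg_angle (\<sigma> + \<tau>) - leg_angle (\<sigma> - \<tau>)\<bar> \<le> 8 * (1536 * \<epsilon>\<^sup>2)"
      using leg_angle_diff[OF ge1] close
      by (smt (verit, best) abs_ge_zero mult_right_mono)
    also have "\<dots> = sqrt \<epsilon> / 20 * (245760 * (\<epsilon> * sqrt \<epsilon>))"
      using sq(1) by (simp add: power2_eq_square)
    finally have "\<bar>leg_angle (\<sigma> + \<tau>) - leg_angle (\<sigma> - \<tau>)\<bar> \<le> 245760 * (\<epsilon> * sqrt \<epsilon>)"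
      by (rule mult_left_le_imp_le) (use sq(2) in simp)
    also have "\<dots> \<le> 300000 * (\<epsilon> * sqrt \<epsilon>)"
      using \<epsilon> by simp
    finally show "pi / 2 \<le> \<sigma> - \<tau> \<and> \<sigma> + \<tau> \<le> 5 * pi / 6 \<and>
        \<bar>leg_angle (\<sigma> + \<tau>) - leg_angle (\<sigma> - \<tau>)\<bar> \<le> 300000 * (\<epsilon> * sqrt \<epsilon>)"
      using range by blast
  qed
qed

text \<open>In units of \<open>h = pi / (n + 1)\<close> the pair has centre \<open>p\<close> just
  before the fold and half-distance \<open>q\<close> just above \<open_tau>.\<close>

lemma close_nodes:
  assumes n: "n \<ge> 4000"
  obtains j k where "j \<le> n div 2" "k \<le> n div 2" "j \<noteq> k"
    "1 \<le> leg_sq (node_angle n j)" "1 \<le> leg_sq (node_angle n k)"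
    "\<bar>leg_angle (node_angle n j) - leg_angle (node_angle n k)\<bar> \<le> 2400000 / (real n * sqrt (real n))"
proof -
  define N \<kappa> where "N = n + 1" and "\<kappa> = n mod 2"
  \<comment> \<open>The largest \<open>p\<close> with \<open>p * h\<close> strictly below
    \<open>2 * pi / 3\<close>; the remainder \<open>e\<close> is 1, 2 or 3, so \<epsilon> lies
    between \<open>h / 3\<close> and \<open>h\<close>.\<close>
  define p where "p = (2 * N - 1) div 3"
  define e where "e = 2 * N - 3 * p"
  define h where "h = pi / real N"
  define \<epsilon> where "\<epsilon> = real e * h / 3"
  have e: "1 \<le> e" "e \<le> 3" "2 * N = 3 * p + e"
    unfolding e_def p_def N_def by presburger+
  have N: "real N > 4000" "real N = real n + 1"
    using n by (auto simp: N_def)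
  have h: "0 < h" "h < 4 / real N" "real N * h = pi"
    using N pi_less_4 by (auto simp: h_def intro!: divide_strict_right_mono)
  have h_small: "h \<le> 1 / 1000"
  proof -
    have "4 / real N \<le> 4 / 4000"
      using N by (intro divide_left_mono) auto
    then show ?thesis
      using h by simp
  qed
  have \<epsilon>: "h / 3 \<le> \<epsilon>" "\<epsilon> \<le> h" "0 < \<epsilon>" "\<epsilon> \<le> 1 / 1000"
  proof -
    have "1 * h \<le> real e * h" "real e * h \<le> 3 * h"
      using e h(1) by (intro mult_right_mono; simp)+
    then show "h / 3 \<le> \<epsilon>" "\<epsilon> \<le> h" "0 < \<epsilon>" "\<epsilon> \<le> 1 / 1000"
      using h(1) h_small unfolding \<epsilon>_def by linarith+
  qed
  define \<sigma> where "\<sigma> = 2 * pi / 3 - \<epsilon>"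
  have "real (2 * N) = real (3 * p + e)"
    using e(3) by (simp only:)
  then have "2 * (real N * h) = (3 * real p + real e) * h"
    by simp
  then have \<sigma>: "\<sigma> = real p * h"
    unfolding h(3) by (simp add: \<sigma>_def \<epsilon>_def algebra_simps)
  obtain \<tau>\<^sub>0 where \<tau>\<^sub>0: "0 < \<tau>\<^sub>0" "\<And>\<tau>. \<tau>\<^sub>0 \<le> \<tau> \<Longrightarrow> \<tau> \<le> \<tau>\<^sub>0 + 6 * \<epsilon> \<Longrightarrow>
      pi / 2 \<le> \<sigma> - \<tau> \<and> \<sigma> + \<tau> \<le> 5 * pi / 6 \<and>
      \<bar>leg_angle (\<sigma> + \<tau>) - leg_angle (\<sigma> - \<tau>)\<bar> \<le> 300000 * (\<epsilon> * sqrt \<epsilon>)"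
    using fold_near_tip[OF \<epsilon>(3,4)] unfolding \<sigma>_def by blast
  define q\<^sub>0 where "q\<^sub>0 = nat \<lceil>\<tau>\<^sub>0 / h\<rceil>"
  have q\<^sub>0: "\<tau>\<^sub>0 / h \<le> real q\<^sub>0" "real q\<^sub>0 < \<tau>\<^sub>0 / h + 1"
    unfolding q\<^sub>0_def using \<tau>\<^sub>0(1) h(1) by (auto simp: le_of_int_ceiling) linarith+
  \<comment> \<open>The angles \<open>(p + q) * h\<close> and \<open>(p - q) * h\<close> are on the
    grid only if \<open>p + q\<close> has the parity of \<open>n\<close>. Rounding up and this
    correction cost at most \<open>2 * h \<le> 6 * \<epsilon>\<close>.\<close>
  define q where "q = (if even (p + q\<^sub>0 + \<kappa>) then q\<^sub>0 else q\<^sub>0 + 1)"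
  have q: "even (p + q + \<kappa>)" "\<tau>\<^sub>0 / h \<le> real q" "real q \<le> \<tau>\<^sub>0 / h + 2"
    using q\<^sub>0 by (auto simp: q_def)
  have \<tau>: "\<tau>\<^sub>0 \<le> real q * h" "real q * h \<le> \<tau>\<^sub>0 + 6 * \<epsilon>"
  proof -
    show "\<tau>\<^sub>0 \<le> real q * h"
      using q(2) h(1) by (simp add: field_simps)
    have "real q * h \<le> \<tau>\<^sub>0 + 2 * h"
      using mult_right_mono[OF q(3), of h] h(1) by (simp add: distrib_right)
    then show "real q * h \<le> \<tau>\<^sub>0 + 6 * \<epsilon>"
      using \<epsilon>(1) by linarith
  qed
  note fold = \<tau>\<^sub>0(2)[OF \<tau>]
  have "0 < real q * h"
    using \<tau>(1) \<tau>\<^sub>0(1) by linarith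
  then have q_pos: "q > 0"
    by (cases q) auto
  \<comment> \<open>Keeps the natural subtractions in \<open>j\<close> and \<open>k\<close>
    exact.\<close>
  have diff: "q + \<kappa> \<le> p"
  proof -
    have "1 * h \<le> pi / 2"
      using h_small pi_gt3 by linarith
    then have "h \<le> real p * h - real q * h"
      using fold unfolding \<sigma> by linarith
    then have "(real q + 1) * h \<le> real p * h"
      by (simp add: algebra_simps)
    then have "real q + 1 \<le> real p"
      using h(1) by simp
    then have "q + 1 \<le> p"
      by linarith
    moreover have "\<kappa> \<le> 1"
      unfolding \<kappa>_def by presburger
    ultimately show ?thesis
      by linarith
  qed
  have sum: "p + q < N"
  proof -
    have "real p * h + real q * h < real N * h"
      using fold pi_gt3 unfolding \<sigma> h(3) by linarith
    then have "real (p + q) * h < real N * h"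
      by (simp add: algebra_simps)
    then show ?thesis
      using h(1) by (simp only: mult_less_cancel_right_pos of_nat_less_iff)
  qed
  obtain c where c: "p + q + \<kappa> = 2 * c"
    using q(1) by (rule evenE)
  define j k where "j = c - \<kappa>" and "k = c - \<kappa> - q"
  have jk: "2 * j + \<kappa> = p + q" "2 * k + \<kappa> + q = p"
    using c diff unfolding j_def k_def by linarith+
  have node: "node_angle n j = \<sigma> + real q * h" "node_angle n k = \<sigma> - real q * h"
  proof -
    have angle: "node_angle n i = real (2 * i + \<kappa>) * h" for i
      by (simp add: node_angle_def h_def N_def \<kappa>_def)
    show "node_angle n j = \<sigma> + real q * h"
      unfolding angle \<sigma> jk(1) by (simp add: distrib_right)
    have "real p = real (2 * k + \<kappa>) + real q"
      using jk(2) by linarith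
    then show "node_angle n k = \<sigma> - real q * h"
      unfolding angle \<sigma> by (simp add: algebra_simps)
  qed
  show thesis
  proof (rule that)
    show "j \<le> n div 2"
      using sum jk(1) unfolding N_def \<kappa>_def by presburger
    then show "k \<le> n div 2"
      using jk by linarith
    show "j \<noteq> k"
      using jk q_pos by auto
    show "1 \<le> leg_sq (node_angle n j)" "1 \<le> leg_sq (node_angle n k)"
      unfolding node using fold \<open>0 < real q * h\<close> by (auto intro!: leg_sq_ge_1)
    have "\<epsilon> \<le> 4 / real n"
    proof -
      have "4 / real N \<le> 4 / real n"
        using N n by (intro divide_left_mono) auto
      then show ?thesis
        using \<epsilon>(2) h(2) by linarith
    qed
    then have "\<epsilon> * sqrt \<epsilon> \<le> 4 / real n * sqrt (4 / real n)"
      using \<epsilon>(3) by (intro mult_mono) auto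
    also have "\<dots> = 8 / (real n * sqrt (real n))"
      by (simp add: real_sqrt_divide)
    finally show "\<bar>leg_angle (node_angle n j) - leg_angle (node_angle n k)\<bar>
        \<le> 2400000 / (real n * sqrt (real n))"
      using fold unfolding node by simp
  qed
qed

section \<open>Growth of the Lebesgue constant and comparison with the logarithm\<close>

lemma sqrt_le_lebesgue_constant:
  assumes "n > 0"
  shows "sqrt (real n) \<le> 10 ^ 7 * lebesgue_constant gamma0 n (fejer_point n)"
proof (cases "n \<ge> 4000")
  case True
  obtain j k where jk: "j \<le> n div 2" "k \<le> n div 2" "j \<noteq> k"
    "1 \<le> leg_sq (node_angle n j)" "1 \<le> leg_sq (node_angle n k)"
    "\<bar>leg_angle (node_angle n j) - leg_angle (node_angle n k)\<bar> \<le> 2400000 / (real n * sqrt (real n))"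
    using close_nodes[OF True] .
  let ?L = "lebesgue_constant gamma0 n (fejer_point n)"
  \<comment> \<open>The gap of order \<open>n powr (- 3 / 2)\<close> against the factor
    \<open>n\<close> leaves \<open>sqrt n\<close>; the constant is
    \<open>3 * 2400000\<close>.\<close>
  have "1 \<le> 3 * real n * ?L * \<bar>leg_angle (node_angle n j) - leg_angle (node_angle n k)\<bar>"
    using lebesgue_constant_ge_inverse_gap[OF assms jk(1-3) leg_angle(2)[OF jk(4)] leg_angle(2)[OF jk(5)]] .
  also have "\<dots> \<le> 3 * real n * ?L * (2400000 / (real n * sqrt (real n)))"
    using jk(6) lebesgue_constant_ge_1[of n] by (intro mult_left_mono) auto
  also have "\<dots> = 7200000 * ?L / sqrt (real n)"
    using assms by simp
  finally have "sqrt (real n) \<le> 7200000 * ?L"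
    using assms by (simp add: field_simps)
  then show ?thesis
    using lebesgue_constant_ge_1[of n] by simp
next
  case False
  then have "sqrt (real n) \<le> 64"
    by (intro real_le_lsqrt) auto
  then show ?thesis
    using lebesgue_constant_ge_1[of n] by simp
qed

text \<open>Apply \<open>ln y \<le> y\<close> to the fourth root of \<open>x\<close>.\<close>

lemma ln_sq_le_sqrt:
  assumes "x \<ge> (1::real)"
  shows "(ln x)\<^sup>2 \<le> 16 * sqrt x"
proof -
  have "ln x = 4 * ln (sqrt (sqrt x))"
    using assms by (simp add: ln_sqrt)
  also have "\<dots> \<le> 4 * sqrt (sqrt x)"
    using assms ln_bound[of "sqrt (sqrt x)"] by simp
  finally have "(ln x)\<^sup>2 \<le> (4 * sqrt (sqrt x))\<^sup>2"
    using assms by (intro power_mono) auto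
  then show ?thesis
    using assms by (simp add: power_mult_distrib)
qed

theorem theorem1:
  shows "(\<exists>c\<^sub>1>0. \<forall>n\<ge>1.
            c\<^sub>1 * (ln (real n))\<^sup>2 \<le> lebesgue_constant gamma0 n (fejer_point n))
       \<and> limsup (\<lambda>n. ereal (lebesgue_constant gamma0 n (fejer_point n) / (ln (real n))\<^sup>2)) = \<infinity>"
proof
  let ?L = "\<lambda>n. lebesgue_constant gamma0 n (fejer_point n)"
  have "1 / (16 * 10 ^ 7) * (ln (real n))\<^sup>2 \<le> ?L n" if "n \<ge> 1" for n
    using ln_sq_le_sqrt[of "real n"] sqrt_le_lebesgue_constant[of n] that by simp
  then show "\<exists>c\<^sub>1>0. \<forall>n\<ge>1. c\<^sub>1 * (ln (real n))\<^sup>2 \<le> ?L n"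
    by (intro exI[of _ "1 / (16 * 10 ^ 7)"]) auto
  \<comment> \<open>The quotient even tends to infinity, being at least this one for positive
    \<open>n\<close>.\<close>
  have "filterlim (\<lambda>n::nat. sqrt (real n) / 10 ^ 7 / (ln (real n))\<^sup>2) at_top sequentially"
    by real_asymp
  moreover have "eventually (\<lambda>n. sqrt (real n) / 10 ^ 7 / (ln (real n))\<^sup>2 \<le> ?L n / (ln (real n))\<^sup>2)
      sequentially"
    using eventually_gt_at_top[of 0]
  proof eventually_elim
    case (elim n)
    then show ?case
      using sqrt_le_lebesgue_constant[of n] by (intro divide_right_mono) auto
  qed
  ultimately have "filterlim (\<lambda>n. ?L n / (ln (real n))\<^sup>2) at_top sequentially"
    by (rule filterlim_at_top_mono)
  then have "(\<lambda>n. ereal (?L n / (ln (real n))\<^sup>2)) \<longlonglongrightarrow> \<infinity>"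
    by (simp add: tendsto_PInfty_eq_at_top)
  then show "limsup (\<lambda>n. ereal (?L n / (ln (real n))\<^sup>2)) = \<infinity>"
    by (intro lim_imp_Limsup) auto
qed

end
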